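(* (1) Let $A$ be any commutative unital ring, $G=\mathrm{GL}_{2,A}$, $N\subseteq G$ the schematic normalizer of the diagonal torus $T$, and $V$ the left standard comodule on $G$. There is an isomorphism of $k[N]$-comodules (and of $k[T]$-comodules) $\mathrm{Sym}^2(V)\cong \mathrm{S}_2(V)$. (2) Let $G=\mathrm{GL}_{2,\mathbf{Z}}$, where $\mathbf{Z}$ is the ring of integers, and let $V$ be the left standard comodule on $G$. Then the $k[G]$-comodules $\mathrm{Sym}^2(V)$ and $\mathrm{S}_2(V)$ are not isomorphic.
   Context: $k[X]$ denotes the coordinate ring (over the base ring $A$) of an affine $A$-scheme $X$. Let $D=x_{11}x_{22}-x_{12}x_{21}$ and $\mathrm{GL}_{2,A}=\mathrm{Spec}(k[G])$, $k[G]=A[x_{ij},1/D]$, with comultiplication $x_{ij}\mapsto\sum_l x_{il}\otimes x_{lj}$. Put $I_1=(x_{12},x_{21})$, $I_2=(x_{11},x_{22})$. The diagonal torus is $T=\mathrm{Spec}(k[T])$, $k[T]=k[G]/I_1$, and its schematic normalizer is $N=\mathrm{Spec}(k[N])$, $k[N]=k[G]/I_1I_2$. The left standard comodule on $\mathrm{GL}_{2,A}$ is the free module $V=A\{e_1,e_2\}$ with $\Delta:V\to V\otimes_A k[G]$, $\Delta(e_1)=e_1\otimes x_{11}+e_2\otimes x_{21}$, $\Delta(e_2)=e_1\otimes x_{12}+e_2\otimes x_{22}$. The symmetric power $\mathrm{Sym}^2(V)$ and the tensor power $V\otimes_A V$ carry the induced $k[G]$-comodule structures. The symmetric tensors $\mathrm{S}_2(V)\subseteq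 V\otimes_A V$ are the invariants under the action of the symmetric group on two elements exchanging tensor factors; $\mathrm{S}_2(V)$ is a sub-$k[G]$-comodule, free on $e_1\otimes e_1$, $e_1\otimes e_2+e_2\otimes e_1$, $e_2\otimes e_2$. The $k[N]$- and $k[T]$-comodule structures are obtained from the $k[G]$-comodule structures via $k[G]\to k[N]\to k[T]$. *)

theory Defs
  imports "HOL-Algebra.UnivPoly" "HOL-Algebra.Ideal_Product" "HOL-Algebra.IntRing"
begin

section \<open>Modules over a commutative ring\<close>

text \<open>
  Modules are records of type \<open>module\<close> from HOL-Algebra; their fields \<open>mult\<close> and \<open>one\<close> play no role
  and are left \<open>undefined\<close> whenever the module is not an algebra.
\<close>

definition linear_maps ::
    "('a, 'r) ring_scheme \<Rightarrow> ('a, 'm, 'x) module_scheme \<Rightarrow> ('a, 'n, 'y) module_scheme \<Rightarrow> ('m \<Rightarrow> 'n) set"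
  where "linear_maps R M N =
    {f \<in> carrier M \<rightarrow> carrier N.
      (\<forall>x\<in>carrier M. \<forall>y\<in>carrier M. f (x \<oplus>\<^bsub>M\<^esub> y) = f x \<oplus>\<^bsub>N\<^esub> f y) \<and>
      (\<forall>a\<in>carrier R. \<forall>x\<in>carrier M. f (a \<odot>\<^bsub>M\<^esub> x) = a \<odot>\<^bsub>N\<^esub> f x)}"

definition span_module ::
    "('a, 'r) ring_scheme \<Rightarrow> ('a, 'm, 'x) module_scheme \<Rightarrow> 'm set \<Rightarrow> 'm set"
  where "span_module R M X = \<Inter>{H. submodule H R M \<and> X \<subseteq> H}"

definition quot_module :: "('a, 'm, 'x) module_scheme \<Rightarrow> 'm set \<Rightarrow> ('a, 'm set) module"
  where "quot_module M U =
    \<lparr>carrier = a_rcosets\<^bsub>M\<^esub> U, monoid.mult = undefined, one = undefined, zero = U, add = set_add M,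
     smult = (\<lambda>a X. \<Union>x\<in>X. U +>\<^bsub>M\<^esub> (a \<odot>\<^bsub>M\<^esub> x))\<rparr>"

text \<open>The free module on \<open>S\<close>: finitely supported functions on \<open>S\<close>, extended by zero outside \<open>S\<close>.\<close>

definition free_module :: "('a, 'r) ring_scheme \<Rightarrow> 's set \<Rightarrow> ('a, 's \<Rightarrow> 'a) module"
  where "free_module R S =
    \<lparr>carrier = {f. (\<forall>s\<in>S. f s \<in> carrier R) \<and> (\<forall>s. s \<notin> S \<longrightarrow> f s = \<zero>\<^bsub>R\<^esub>) \<and> finite {s. f s \<noteq> \<zero>\<^bsub>R\<^esub>}},
     monoid.mult = undefined, one = undefined, zero = (\<lambda>s. \<zero>\<^bsub>R\<^esub>), add = (\<lambda>f g s. f s \<oplus>\<^bsub>R\<^esub> g s),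
     smult = (\<lambda>a f s. a \<otimes>\<^bsub>R\<^esub> f s)\<rparr>"

definition unit_vec :: "('a, 'r) ring_scheme \<Rightarrow> 's \<Rightarrow> 's \<Rightarrow> 'a"
  where "unit_vec R s = (\<lambda>t. if t = s then \<one>\<^bsub>R\<^esub> else \<zero>\<^bsub>R\<^esub>)"

text \<open>The linear map from a free module to \<open>P\<close> that sends \<open>unit_vec R s\<close> to \<open>g s\<close>.\<close>

definition lin_ext ::
    "('a, 'r) ring_scheme \<Rightarrow> ('a, 'p, 'x) module_scheme \<Rightarrow> ('s \<Rightarrow> 'p) \<Rightarrow> ('s \<Rightarrow> 'a) \<Rightarrow> 'p"
  where "lin_ext R P g f = (\<Oplus>\<^bsub>P\<^esub>s\<in>{s. f s \<noteq> \<zero>\<^bsub>R\<^esub>}. f s \<odot>\<^bsub>P\<^esub> g s)"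


section \<open>Tensor products\<close>

text \<open>
  The tensor product of \<open>M\<close> and \<open>N\<close> over \<open>R\<close> is the free module on the pairs \<open>(m, n)\<close> modulo the
  relations expressing bilinearity.
\<close>

type_synonym ('a, 'm, 'n) tensor = "('m \<times> 'n \<Rightarrow> 'a) set"

definition tensor_rels ::
    "('a, 'r) ring_scheme \<Rightarrow> ('a, 'm, 'x) module_scheme \<Rightarrow> ('a, 'n, 'y) module_scheme \<Rightarrow> ('m \<times> 'n \<Rightarrow> 'a) set"
  where "tensor_rels R M N =
    (let F = free_module R (carrier M \<times> carrier N); \<delta> = (\<lambda>m n. unit_vec R (m, n)) in
      {\<delta> (m \<oplus>\<^bsub>M\<^esub> m') n \<ominus>\<^bsub>F\<^esub> (\<delta> m n \<oplus>\<^bsub>F\<^esub> \<delta> m' n) | m m' n.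
          m \<in> carrier M \<and> m' \<in> carrier M \<and> n \<in> carrier N}
    \<union> {\<delta> m (n \<oplus>\<^bsub>N\<^esub> n') \<ominus>\<^bsub>F\<^esub> (\<delta> m n \<oplus>\<^bsub>F\<^esub> \<delta> m n') | m n n'.
          m \<in> carrier M \<and> n \<in> carrier N \<and> n' \<in> carrier N}
    \<union> {\<delta> (a \<odot>\<^bsub>M\<^esub> m) n \<ominus>\<^bsub>F\<^esub> (a \<odot>\<^bsub>F\<^esub> \<delta> m n) | a m n.
          a \<in> carrier R \<and> m \<in> carrier M \<and> n \<in> carrier N}
    \<union> {\<delta> m (a \<odot>\<^bsub>N\<^esub> n) \<ominus>\<^bsub>F\<^esub> (a \<odot>\<^bsub>F\<^esub> \<delta> m n) | a m n.
          a \<in> carrier R \<and> m \<in> carrier M \<and> n \<in> carrier N})"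

definition tensor_ker ::
    "('a, 'r) ring_scheme \<Rightarrow> ('a, 'm, 'x) module_scheme \<Rightarrow> ('a, 'n, 'y) module_scheme \<Rightarrow> ('m \<times> 'n \<Rightarrow> 'a) set"
  where "tensor_ker R M N =
    span_module R (free_module R (carrier M \<times> carrier N)) (tensor_rels R M N)"

definition tensor_module ::
    "('a, 'r) ring_scheme \<Rightarrow> ('a, 'm, 'x) module_scheme \<Rightarrow> ('a, 'n, 'y) module_scheme
      \<Rightarrow> ('a, ('a, 'm, 'n) tensor) module"
  where "tensor_module R M N =
    quot_module (free_module R (carrier M \<times> carrier N)) (tensor_ker R M N)"

definition pure_tensor ::
    "('a, 'r) ring_scheme \<Rightarrow> ('a, 'm, 'x) module_scheme \<Rightarrow> ('a, 'n, 'y) module_scheme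
      \<Rightarrow> 'm \<Rightarrow> 'n \<Rightarrow> ('a, 'm, 'n) tensor"
  where "pure_tensor R M N m n =
    tensor_ker R M N +>\<^bsub>free_module R (carrier M \<times> carrier N)\<^esub> unit_vec R (m, n)"

text \<open>
  For bilinear \<open>\<beta>\<close>, the linear map to \<open>P\<close> that sends the tensor of \<open>m\<close> and \<open>n\<close> to \<open>\<beta> m n\<close>. It is
  computed on an arbitrary representative; bilinearity of \<open>\<beta>\<close> makes the choice immaterial.
\<close>

definition tensor_lift ::
    "('a, 'r) ring_scheme \<Rightarrow> ('a, 'p, 'x) module_scheme \<Rightarrow> ('m \<Rightarrow> 'n \<Rightarrow> 'p)
      \<Rightarrow> ('a, 'm, 'n) tensor \<Rightarrow> 'p"
  where "tensor_lift R P \<beta> X = lin_ext R P (\<lambda>(m, n). \<beta> m n) (SOME f. f \<in> X)"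

text \<open>The tensor product of two linear maps; only the target modules need to be given.\<close>

definition tensor_map ::
    "('a, 'r) ring_scheme \<Rightarrow> ('a, 'k, 'x) module_scheme \<Rightarrow> ('a, 'l, 'y) module_scheme
      \<Rightarrow> ('m \<Rightarrow> 'k) \<Rightarrow> ('n \<Rightarrow> 'l) \<Rightarrow> ('a, 'm, 'n) tensor \<Rightarrow> ('a, 'k, 'l) tensor"
  where "tensor_map R K L f g =
    tensor_lift R (tensor_module R K L) (\<lambda>m n. pure_tensor R K L (f m) (g n))"


section \<open>Comodules\<close>

text \<open>
  A right comodule over a bialgebra \<open>C\<close> with elements of type \<open>'c\<close> is a module \<open>M\<close> together with its
  coaction \<open>M \<rightarrow> M \<otimes> C\<close>. Neither the constructions below nor the notion of isomorphism refer to the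
  comultiplication and the counit of \<open>C\<close>; only the algebra structure of \<open>C\<close> is needed, for the
  coaction on a tensor product.
\<close>

record ('a, 'm, 'c) comod = "('a, 'm) module" +
  coact :: "'m \<Rightarrow> ('a, 'm, 'c) tensor"

definition comod_iso ::
    "('a, 'r) ring_scheme \<Rightarrow> ('a, 'c, 'z) module_scheme
      \<Rightarrow> ('a, 'm, 'c, 'x) comod_scheme \<Rightarrow> ('a, 'n, 'c, 'y) comod_scheme \<Rightarrow> ('m \<Rightarrow> 'n) set"
  where "comod_iso R C M N =
    {\<phi> \<in> linear_maps R M N. bij_betw \<phi> (carrier M) (carrier N) \<and>
      (\<forall>m\<in>carrier M. coact N (\<phi> m) = tensor_map R N C \<phi> id (coact M m))}"

text \<open>Extension of the coaction along a homomorphism \<open>\<pi>\<close> to \<open>C'\<close>.\<close>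

definition comod_along ::
    "('a, 'r) ring_scheme \<Rightarrow> ('a, 'd, 'z) module_scheme \<Rightarrow> ('c \<Rightarrow> 'd)
      \<Rightarrow> ('a, 'm, 'c, 'x) comod_scheme \<Rightarrow> ('a, 'm, 'd) comod"
  where "comod_along R C' \<pi> M =
    module.extend (module.truncate M) (comod.fields (\<lambda>m. tensor_map R M C' id \<pi> (coact M m)))"

text \<open>The coaction of a tensor product: if \<open>m \<mapsto> \<Sum> m\<^sub>i \<otimes> c\<^sub>i\<close> and \<open>n \<mapsto> \<Sum> n\<^sub>j \<otimes> d\<^sub>j\<close>, then
  \<open>m \<otimes> n \<mapsto> \<Sum> (m\<^sub>i \<otimes> n\<^sub>j) \<otimes> c\<^sub>i d\<^sub>j\<close>.\<close>

definition coact_mult ::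
    "('a, 'r) ring_scheme \<Rightarrow> ('a, 'c, 'z) module_scheme
      \<Rightarrow> ('a, 'm, 'x) module_scheme \<Rightarrow> ('a, 'n, 'y) module_scheme
      \<Rightarrow> ('a, 'm, 'c) tensor \<Rightarrow> ('a, 'n, 'c) tensor \<Rightarrow> ('a, ('a, 'm, 'n) tensor, 'c) tensor"
  where "coact_mult R C M N s t =
    (let MN = tensor_module R M N; P = tensor_module R MN C in
      tensor_lift R P (\<lambda>m c. tensor_lift R P
        (\<lambda>n d. pure_tensor R MN C (pure_tensor R M N m n) (c \<otimes>\<^bsub>C\<^esub> d)) t) s)"

definition tensor_comod ::
    "('a, 'r) ring_scheme \<Rightarrow> ('a, 'c, 'z) module_scheme
      \<Rightarrow> ('a, 'm, 'c, 'x) comod_scheme \<Rightarrow> ('a, 'n, 'c, 'y) comod_scheme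
      \<Rightarrow> ('a, ('a, 'm, 'n) tensor, 'c) comod"
  where "tensor_comod R C M N =
    module.extend (tensor_module R M N)
      (comod.fields (tensor_lift R (tensor_module R (tensor_module R M N) C)
        (\<lambda>m n. coact_mult R C M N (coact M m) (coact N n))))"

definition quot_comod ::
    "('a, 'r) ring_scheme \<Rightarrow> ('a, 'c, 'z) module_scheme
      \<Rightarrow> ('a, 'm, 'c, 'x) comod_scheme \<Rightarrow> 'm set \<Rightarrow> ('a, 'm set, 'c) comod"
  where "quot_comod R C M U =
    module.extend (quot_module M U)
      (comod.fields (\<lambda>X. tensor_map R (quot_module M U) C (\<lambda>m. U +>\<^bsub>M\<^esub> m) id
        (coact M (SOME m. m \<in> X))))"

text \<open>The coaction of a subcomodule \<open>U\<close> is the restriction of the coaction of \<open>M\<close>, factored through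
  the map \<open>U \<otimes> C \<rightarrow> M \<otimes> C\<close> induced by the inclusion.\<close>

definition sub_comod ::
    "('a, 'r) ring_scheme \<Rightarrow> ('a, 'c, 'z) module_scheme
      \<Rightarrow> ('a, 'm, 'c, 'x) comod_scheme \<Rightarrow> 'm set \<Rightarrow> ('a, 'm, 'c) comod"
  where "sub_comod R C M U =
    module.extend (module.truncate M \<lparr>carrier := U\<rparr>)
      (comod.fields (\<lambda>u. THE t. t \<in> carrier (tensor_module R (M \<lparr>carrier := U\<rparr>) C) \<and>
        tensor_map R M C id id t = coact M u))"


section \<open>The coordinate rings of \<open>GL\<^sub>2\<close>, of the diagonal torus and of its normalizer\<close>

definition quot_alg :: "('a, 'c, 'x) module_scheme \<Rightarrow> 'c set \<Rightarrow> ('a, 'c set) module"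
  where "quot_alg C I =
    ring.extend (C Quot I) (module.fields (\<lambda>a X. \<Union>x\<in>X. I +>\<^bsub>C\<^esub> (a \<odot>\<^bsub>C\<^esub> x)))"

text \<open>
  The ring \<open>A[x\<^sub>1\<^sub>1, x\<^sub>1\<^sub>2, x\<^sub>2\<^sub>1, x\<^sub>2\<^sub>2, t]\<close> as an iterated univariate polynomial ring, the variables
  being adjoined in this order. In it, \<open>poly_const A\<close> embeds \<open>A\<close> and \<open>poly_x A i j\<close> is \<open>x\<^sub>i\<^sub>j\<close>.
\<close>

type_synonym 'a poly5 = "nat \<Rightarrow> nat \<Rightarrow> nat \<Rightarrow> nat \<Rightarrow> nat \<Rightarrow> 'a"

definition up_const :: "('b, 'r) ring_scheme \<Rightarrow> 'b \<Rightarrow> nat \<Rightarrow> 'b"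
  where "up_const S a = monom (UP S) a 0"

definition up_var :: "('b, 'r) ring_scheme \<Rightarrow> nat \<Rightarrow> 'b"
  where "up_var S = monom (UP S) \<one>\<^bsub>S\<^esub> 1"

definition poly_const :: "('a, 'r) ring_scheme \<Rightarrow> 'a \<Rightarrow> 'a poly5"
  where "poly_const A a =
    up_const (UP (UP (UP (UP A)))) (up_const (UP (UP (UP A))) (up_const (UP (UP A))
      (up_const (UP A) (up_const A a))))"

definition poly_x :: "('a, 'r) ring_scheme \<Rightarrow> nat \<Rightarrow> nat \<Rightarrow> 'a poly5"
  where "poly_x A i j = up_const (UP (UP (UP (UP A))))
    (if i = 1 then
      if j = 1
      then up_const (UP (UP (UP A))) (up_const (UP (UP A)) (up_const (UP A) (up_var A)))
      else up_const (UP (UP (UP A))) (up_const (UP (UP A)) (up_var (UP A)))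
    else
      if j = 1
      then up_const (UP (UP (UP A))) (up_var (UP (UP A)))
      else up_var (UP (UP (UP A))))"

definition poly_t :: "('a, 'r) ring_scheme \<Rightarrow> 'a poly5"
  where "poly_t A = up_var (UP (UP (UP (UP A))))"

definition poly_alg :: "('a, 'r) ring_scheme \<Rightarrow> ('a, 'a poly5) module"
  where "poly_alg A =
    (let P = UP (UP (UP (UP (UP A)))) in
      ring.extend (ring.truncate P) (module.fields (\<lambda>a p. poly_const A a \<otimes>\<^bsub>P\<^esub> p)))"

text \<open>\<open>A[x\<^sub>i\<^sub>j, 1/D]\<close> is \<open>A[x\<^sub>i\<^sub>j, t]\<close> modulo \<open>t D - 1\<close>.\<close>

definition det_ideal :: "('a, 'r) ring_scheme \<Rightarrow> 'a poly5 set"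
  where "det_ideal A =
    (let P = poly_alg A;
         D = poly_x A 1 1 \<otimes>\<^bsub>P\<^esub> poly_x A 2 2 \<ominus>\<^bsub>P\<^esub> poly_x A 1 2 \<otimes>\<^bsub>P\<^esub> poly_x A 2 1
     in Idl\<^bsub>P\<^esub> {poly_t A \<otimes>\<^bsub>P\<^esub> D \<ominus>\<^bsub>P\<^esub> \<one>\<^bsub>P\<^esub>})"

definition kG :: "('a, 'r) ring_scheme \<Rightarrow> ('a, 'a poly5 set) module"
  where "kG A = quot_alg (poly_alg A) (det_ideal A)"

definition kG_x :: "('a, 'r) ring_scheme \<Rightarrow> nat \<Rightarrow> nat \<Rightarrow> 'a poly5 set"
  where "kG_x A i j = det_ideal A +>\<^bsub>poly_alg A\<^esub> poly_x A i j"

definition ideal_I1 :: "('a, 'r) ring_scheme \<Rightarrow> 'a poly5 set set"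
  where "ideal_I1 A = Idl\<^bsub>kG A\<^esub> {kG_x A 1 2, kG_x A 2 1}"

definition ideal_I2 :: "('a, 'r) ring_scheme \<Rightarrow> 'a poly5 set set"
  where "ideal_I2 A = Idl\<^bsub>kG A\<^esub> {kG_x A 1 1, kG_x A 2 2}"

definition kT :: "('a, 'r) ring_scheme \<Rightarrow> ('a, 'a poly5 set set) module"
  where "kT A = quot_alg (kG A) (ideal_I1 A)"

definition kN :: "('a, 'r) ring_scheme \<Rightarrow> ('a, 'a poly5 set set) module"
  where "kN A = quot_alg (kG A) (ideal_I1 A \<cdot>\<^bsub>kG A\<^esub> ideal_I2 A)"

definition kG_to_kN :: "('a, 'r) ring_scheme \<Rightarrow> 'a poly5 set \<Rightarrow> 'a poly5 set set"
  where "kG_to_kN A c = (ideal_I1 A \<cdot>\<^bsub>kG A\<^esub> ideal_I2 A) +>\<^bsub>kG A\<^esub> c"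

text \<open>The class of \<open>c\<close> modulo \<open>I\<^sub>1 I\<^sub>2\<close> is mapped to the class of \<open>c\<close> modulo \<open>I\<^sub>1\<close>.\<close>

definition kN_to_kT :: "('a, 'r) ring_scheme \<Rightarrow> 'a poly5 set set \<Rightarrow> 'a poly5 set set"
  where "kN_to_kT A X = ideal_I1 A <+>\<^bsub>kG A\<^esub> X"


section \<open>The standard comodule, its symmetric square and its symmetric tensors\<close>

definition std_module :: "('a, 'r) ring_scheme \<Rightarrow> ('a, nat \<Rightarrow> 'a) module"
  where "std_module A = free_module A {1, 2}"

definition std_comod :: "('a, 'r) ring_scheme \<Rightarrow> ('a, nat \<Rightarrow> 'a, 'a poly5 set) comod"
  where "std_comod A =
    (let V = std_module A; P = tensor_module A V (kG A) in
      module.extend V (comod.fields (lin_ext A P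
        (\<lambda>j. \<Oplus>\<^bsub>P\<^esub>i\<in>{1, 2}. pure_tensor A V (kG A) (unit_vec A i) (kG_x A i j)))))"

definition VV_comod ::
    "('a, 'r) ring_scheme \<Rightarrow> ('a, ('a, nat \<Rightarrow> 'a, nat \<Rightarrow> 'a) tensor, 'a poly5 set) comod"
  where "VV_comod A = tensor_comod A (kG A) (std_comod A) (std_comod A)"

definition Sym2_comod ::
    "('a, 'r) ring_scheme \<Rightarrow> ('a, ('a, nat \<Rightarrow> 'a, nat \<Rightarrow> 'a) tensor set, 'a poly5 set) comod"
  where "Sym2_comod A =
    (let V = std_comod A in
      quot_comod A (kG A) (VV_comod A) (span_module A (VV_comod A)
        {pure_tensor A V V v w \<ominus>\<^bsub>VV_comod A\<^esub> pure_tensor A V V w v | v w.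
          v \<in> carrier V \<and> w \<in> carrier V}))"

definition tensor_swap ::
    "('a, 'r) ring_scheme \<Rightarrow> ('a, nat \<Rightarrow> 'a, nat \<Rightarrow> 'a) tensor \<Rightarrow> ('a, nat \<Rightarrow> 'a, nat \<Rightarrow> 'a) tensor"
  where "tensor_swap A =
    tensor_lift A (VV_comod A) (\<lambda>v w. pure_tensor A (std_comod A) (std_comod A) w v)"

definition S2_comod ::
    "('a, 'r) ring_scheme \<Rightarrow> ('a, ('a, nat \<Rightarrow> 'a, nat \<Rightarrow> 'a) tensor, 'a poly5 set) comod"
  where "S2_comod A = sub_comod A (kG A) (VV_comod A) {t \<in> carrier (VV_comod A). tensor_swap A t = t}"

definition res_N ::
    "('a, 'r) ring_scheme \<Rightarrow> ('a, 'm, 'a poly5 set) comod \<Rightarrow> ('a, 'm, 'a poly5 set set) comod"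
  where "res_N A M = comod_along A (kN A) (kG_to_kN A) M"

definition res_T ::
    "('a, 'r) ring_scheme \<Rightarrow> ('a, 'm, 'a poly5 set) comod \<Rightarrow> ('a, 'm, 'a poly5 set set) comod"
  where "res_T A M = comod_along A (kT A) (kN_to_kT A) (res_N A M)"


section \<open>Well-definedness\<close>

text \<open>
  The maps above that are computed on chosen representatives, or described by a definite
  description, do not depend on the choice: \<open>tensor_lift\<close> satisfies the universal property of the
  tensor product, the coaction of \<open>Sym2_comod\<close> is induced by that of \<open>VV_comod\<close> (\<open>Sym2_coact\<close>), and
  that of \<open>VV_comod\<close> restricts uniquely to \<open>S2_comod\<close> (\<open>S2_coact\<close>).
\<close>

lemma free_module_simps [simp]:
  "carrier (free_module R S) =
     {f. (\<forall>s\<in>S. f s \<in> carrier R) \<and> (\<forall>s. s \<notin> S \<longrightarrow> f s = \<zero>\<^bsub>R\<^esub>) \<and> finite {s. f s \<noteq> \<zero>\<^bsub>R\<^esub>}}"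
  "zero (free_module R S) = (\<lambda>s. \<zero>\<^bsub>R\<^esub>)"
  "add (free_module R S) = (\<lambda>f g s. f s \<oplus>\<^bsub>R\<^esub> g s)"
  "smult (free_module R S) = (\<lambda>a f s. a \<otimes>\<^bsub>R\<^esub> f s)"
  by (simp_all add: free_module_def)

lemma free_module_module:
  assumes "cring R" shows "module R (free_module R S)"
proof -
  interpret R: cring R by fact
  have cl: "f s \<in> carrier R" if "f \<in> carrier (free_module R S)" for f s
    using that by (cases "s \<in> S") auto
  have ag: "abelian_group (free_module R S)"
  proof (rule abelian_groupI)
    fix f g assume f: "f \<in> carrier (free_module R S)" and g: "g \<in> carrier (free_module R S)"
    have "finite {s. f s \<oplus>\<^bsub>R\<^esub> g s \<noteq> \<zero>\<^bsub>R\<^esub>}"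
      by (rule finite_subset[of _ "{s. f s \<noteq> \<zero>\<^bsub>R\<^esub>} \<union> {s. g s \<noteq> \<zero>\<^bsub>R\<^esub>}"]) (use f g in auto)
    then show "f \<oplus>\<^bsub>free_module R S\<^esub> g \<in> carrier (free_module R S)"
      using f g by auto
  next
    fix f assume f: "f \<in> carrier (free_module R S)"
    have "finite {s. \<ominus>\<^bsub>R\<^esub> f s \<noteq> \<zero>\<^bsub>R\<^esub>}"
      by (rule finite_subset[of _ "{s. f s \<noteq> \<zero>\<^bsub>R\<^esub>}"]) (use f in auto)
    then show "\<exists>g\<in>carrier (free_module R S). g \<oplus>\<^bsub>free_module R S\<^esub> f = \<zero>\<^bsub>free_module R S\<^esub>"
      using f cl[OF f] by (intro bexI[of _ "\<lambda>s. \<ominus>\<^bsub>R\<^esub> f s"]) (auto simp: R.l_neg)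
  qed (auto simp: fun_eq_iff R.a_assoc[OF cl cl cl] R.a_comm[OF cl cl] R.l_zero[OF cl] simp del: free_module_simps(1) intro!: R.a_assoc R.a_comm R.l_zero dest: cl, simp)
  have sm: "a \<odot>\<^bsub>free_module R S\<^esub> f \<in> carrier (free_module R S)"
    if "a \<in> carrier R" "f \<in> carrier (free_module R S)" for a f
  proof -
    have "finite {s. a \<otimes>\<^bsub>R\<^esub> f s \<noteq> \<zero>\<^bsub>R\<^esub>}"
      by (rule finite_subset[of _ "{s. f s \<noteq> \<zero>\<^bsub>R\<^esub>}"]) (use that in auto)
    then show ?thesis using that by auto
  qed
  show ?thesis
    by (rule moduleI[OF assms ag sm])
      (auto simp: fun_eq_iff R.l_distr R.r_distr R.m_assoc cl simp del: free_module_simps(1))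
qed

lemma quot_module_simps [simp]:
  "carrier (quot_module M U) = a_rcosets\<^bsub>M\<^esub> U"
  "zero (quot_module M U) = U"
  "add (quot_module M U) = set_add M"
  "smult (quot_module M U) = (\<lambda>a X. \<Union>x\<in>X. U +>\<^bsub>M\<^esub> (a \<odot>\<^bsub>M\<^esub> x))"
  by (simp_all add: quot_module_def)

lemma submodule_abelian_subgroup:
  assumes "module R M" "submodule U R M" shows "abelian_subgroup U M"
proof -
  interpret module R M by fact
  show ?thesis
    by (rule abelian_subgroupI3) (auto simp: additive_subgroup_def assms(2)[THEN submodule.axioms(1)] M.abelian_group_axioms)
qed

lemma quot_smult:
  assumes "module R M" "submodule U R M" "a \<in> carrier R" "m \<in> carrier M"
  shows "a \<odot>\<^bsub>quot_module M U\<^esub> (U +>\<^bsub>M\<^esub> m) = U +>\<^bsub>M\<^esub> (a \<odot>\<^bsub>M\<^esub> m)"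
proof -
  interpret module R M by fact
  interpret U: abelian_subgroup U M by (rule submodule_abelian_subgroup) fact+
  have "U +>\<^bsub>M\<^esub> (a \<odot>\<^bsub>M\<^esub> y) = U +>\<^bsub>M\<^esub> (a \<odot>\<^bsub>M\<^esub> m)" if "y \<in> U +>\<^bsub>M\<^esub> m" for y
  proof -
    obtain u where u: "u \<in> U" "y = u \<oplus>\<^bsub>M\<^esub> m" using \<open>y \<in> U +>\<^bsub>M\<^esub> m\<close>
      by (auto simp: a_r_coset_def')
    have "a \<odot>\<^bsub>M\<^esub> y = (a \<odot>\<^bsub>M\<^esub> u) \<oplus>\<^bsub>M\<^esub> (a \<odot>\<^bsub>M\<^esub> m)"
      using u assms by (simp add: smult_r_distr)
    moreover have "a \<odot>\<^bsub>M\<^esub> u \<in> U" using submodule.smult_closed[OF assms(2)] u assms by simp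
    ultimately have "a \<odot>\<^bsub>M\<^esub> y \<in> U +>\<^bsub>M\<^esub> (a \<odot>\<^bsub>M\<^esub> m)" by (auto simp: a_r_coset_def')
    then show ?thesis using U.a_repr_independence' assms(3,4) smult_closed by metis
  qed
  moreover have "m \<in> U +>\<^bsub>M\<^esub> m" using U.a_rcos_self assms(4) by simp
  ultimately show ?thesis unfolding quot_module_simps by blast
qed

lemma quot_carrierE:
  assumes "X \<in> carrier (quot_module M U)"
  obtains m where "m \<in> carrier M" "X = U +>\<^bsub>M\<^esub> m"
  using assms by (auto simp: A_RCOSETS_def')

lemma quot_module_module:
  assumes "module R M" "submodule U R M" shows "module R (quot_module M U)"
proof -
  interpret module R M by fact
  interpret U: abelian_subgroup U M by (rule submodule_abelian_subgroup) fact+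
  have c: "U +>\<^bsub>M\<^esub> m \<in> carrier (quot_module M U)" if "m \<in> carrier M" for m
    using that by (auto simp: A_RCOSETS_def')
  have ad: "(U +>\<^bsub>M\<^esub> m) \<oplus>\<^bsub>quot_module M U\<^esub> (U +>\<^bsub>M\<^esub> n) = U +>\<^bsub>M\<^esub> (m \<oplus>\<^bsub>M\<^esub> n)"
    if "m \<in> carrier M" "n \<in> carrier M" for m n
    using that U.a_rcos_sum by simp
  have ag: "abelian_group (quot_module M U)"
  proof (rule abelian_groupI)
    fix X assume "X \<in> carrier (quot_module M U)"
    then obtain m where m: "m \<in> carrier M" "X = U +>\<^bsub>M\<^esub> m" by (rule quot_carrierE)
    have "U +>\<^bsub>M\<^esub> \<zero>\<^bsub>M\<^esub> = U" by (simp add: U.a_subset)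
    with m show "\<exists>Y\<in>carrier (quot_module M U). Y \<oplus>\<^bsub>quot_module M U\<^esub> X = \<zero>\<^bsub>quot_module M U\<^esub>"
      by (intro bexI[of _ "U +>\<^bsub>M\<^esub> (\<ominus>\<^bsub>M\<^esub> m)"]) (simp_all only: ad c M.a_inv_closed M.l_neg quot_module_simps(2))
  next
    have z: "\<zero>\<^bsub>quot_module M U\<^esub> = U +>\<^bsub>M\<^esub> \<zero>\<^bsub>M\<^esub>" by (simp add: U.a_subset)
    show "\<zero>\<^bsub>quot_module M U\<^esub> \<in> carrier (quot_module M U)" unfolding z by (rule c) simp
    fix X assume "X \<in> carrier (quot_module M U)"
    then obtain m where m: "m \<in> carrier M" "X = U +>\<^bsub>M\<^esub> m" by (rule quot_carrierE)
    then show "\<zero>\<^bsub>quot_module M U\<^esub> \<oplus>\<^bsub>quot_module M U\<^esub> X = X" unfolding z by (simp only: ad M.zero_closed M.l_zero)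
  qed (elim quot_carrierE, auto simp: c ad M.a_ac simp del: quot_module_simps)+
  note qs = quot_smult[OF assms]
  show ?thesis
    by (rule moduleI; (elim quot_carrierE)?)
      (auto simp: ag R.cring_axioms c qs ad smult_l_distr smult_r_distr smult_assoc1
         simp del: quot_module_simps)
qed

lemma span_submodule:
  assumes "module R M" "X \<subseteq> carrier M"
  shows "submodule (span_module R M X) R M"
proof -
  interpret module R M by fact
  let ?S = "{H. submodule H R M \<and> X \<subseteq> H}"
  have ne: "carrier M \<in> ?S" using assms carrier_is_submodule by blast
  show ?thesis unfolding span_module_def
    by (rule submoduleI) (use ne in \<open>auto dest: submoduleE subgroup.one_closed[OF submodule.axioms(1)]\<close>, (fastforce dest: subgroup.one_closed[OF submodule.axioms(1)] submoduleE)+)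
qed

lemma span_superset: "s \<in> X \<Longrightarrow> s \<in> span_module R M X"
  unfolding span_module_def by auto

lemma span_least: "submodule H R M \<Longrightarrow> X \<subseteq> H \<Longrightarrow> span_module R M X \<subseteq> H"
  unfolding span_module_def by auto

lemma unit_vec_carrier: "cring R \<Longrightarrow> s \<in> S \<Longrightarrow> unit_vec R s \<in> carrier (free_module R S)"
proof -
  assume "cring R" "s \<in> S"
  interpret cring R by fact
  have "finite {t. unit_vec R s t \<noteq> \<zero>\<^bsub>R\<^esub>}" by (rule finite_subset[of _ "{s}"]) (auto simp: unit_vec_def)
  then show ?thesis using \<open>s \<in> S\<close> by (auto simp: unit_vec_def)
qed

lemma lin_ext_eq:
  assumes "module R P" "g \<in> S \<rightarrow> carrier P" "f \<in> carrier (free_module R S)"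
    "finite T" "T \<subseteq> S" "{s. f s \<noteq> \<zero>\<^bsub>R\<^esub>} \<subseteq> T"
  shows "lin_ext R P g f = (\<Oplus>\<^bsub>P\<^esub>s\<in>T. f s \<odot>\<^bsub>P\<^esub> g s)"
proof -
  interpret module R P by fact
  have gc: "g s \<in> carrier P" if "s \<in> T" for s using assms that by auto
  have fc: "f s \<in> carrier R" if "s \<in> T" for s using assms that by auto
  show ?thesis unfolding lin_ext_def
    by (rule M.add.finprod_mono_neutral_cong_left) (use assms gc fc in auto)
qed

lemma lin_ext_linear:
  assumes "module R P" "g \<in> S \<rightarrow> carrier P"
  shows "lin_ext R P g \<in> linear_maps R (free_module R S) P"
proof -
  interpret module R P by fact
  interpret F: module R "free_module R S" by (rule free_module_module) (rule R.cring_axioms)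
  let ?F = "free_module R S"
  have supp: "finite {s. f s \<noteq> \<zero>\<^bsub>R\<^esub>}" "{s. f s \<noteq> \<zero>\<^bsub>R\<^esub>} \<subseteq> S" "s \<in> S \<Longrightarrow> f s \<in> carrier R"
    if "f \<in> carrier ?F" for f s using that by auto
  have gc: "s \<in> S \<Longrightarrow> g s \<in> carrier P" for s using assms by auto
  show ?thesis unfolding linear_maps_def
  proof (intro CollectI conjI ballI Pi_I)
    fix f assume f: "f \<in> carrier ?F"
    show "lin_ext R P g f \<in> carrier P" unfolding lin_ext_def
      using supp[OF f] gc by (intro M.finsum_closed) auto
  next
    fix f h assume f: "f \<in> carrier ?F" and h: "h \<in> carrier ?F"
    define Z where "Z = {s. f s \<noteq> \<zero>\<^bsub>R\<^esub>} \<union> {s. h s \<noteq> \<zero>\<^bsub>R\<^esub>}"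
    have Z: "finite Z" "Z \<subseteq> S" unfolding Z_def using supp(1,2)[OF f] supp(1,2)[OF h] by blast+
    note e = lin_ext_eq[OF assms _ Z]
    have fc: "f s \<in> carrier R" and hc: "h s \<in> carrier R" and gs: "g s \<in> carrier P" if "s \<in> Z" for s
      using that Z(2) supp(3)[OF f] supp(3)[OF h] gc by blast+
    have "{s. (f \<oplus>\<^bsub>?F\<^esub> h) s \<noteq> \<zero>\<^bsub>R\<^esub>} \<subseteq> Z" by (auto simp: Z_def)
    then have "lin_ext R P g (f \<oplus>\<^bsub>?F\<^esub> h) = (\<Oplus>\<^bsub>P\<^esub>s\<in>Z. (f s \<oplus>\<^bsub>R\<^esub> h s) \<odot>\<^bsub>P\<^esub> g s)"
      by (subst e[OF F.a_closed[OF f h]]) simp_all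
    also have "\<dots> = (\<Oplus>\<^bsub>P\<^esub>s\<in>Z. f s \<odot>\<^bsub>P\<^esub> g s \<oplus>\<^bsub>P\<^esub> h s \<odot>\<^bsub>P\<^esub> g s)"
      by (rule M.finsum_cong') (auto simp: smult_l_distr fc hc gs)
    also have "\<dots> = (\<Oplus>\<^bsub>P\<^esub>s\<in>Z. f s \<odot>\<^bsub>P\<^esub> g s) \<oplus>\<^bsub>P\<^esub> (\<Oplus>\<^bsub>P\<^esub>s\<in>Z. h s \<odot>\<^bsub>P\<^esub> g s)"
      by (rule M.finsum_addf) (auto simp: fc hc gs)
    also have "(\<Oplus>\<^bsub>P\<^esub>s\<in>Z. f s \<odot>\<^bsub>P\<^esub> g s) = lin_ext R P g f"
      by (rule e[OF f, symmetric]) (auto simp: Z_def)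
    also have "(\<Oplus>\<^bsub>P\<^esub>s\<in>Z. h s \<odot>\<^bsub>P\<^esub> g s) = lin_ext R P g h"
      by (rule e[OF h, symmetric]) (auto simp: Z_def)
    finally show "lin_ext R P g (f \<oplus>\<^bsub>?F\<^esub> h) = lin_ext R P g f \<oplus>\<^bsub>P\<^esub> lin_ext R P g h" .
  next
    fix a f assume a: "a \<in> carrier R" and f: "f \<in> carrier ?F"
    define Z where "Z = {s. f s \<noteq> \<zero>\<^bsub>R\<^esub>}"
    have Z: "finite Z" "Z \<subseteq> S" unfolding Z_def using supp(1,2)[OF f] by blast+
    note e = lin_ext_eq[OF assms _ Z]
    have fc: "f s \<in> carrier R" and gs: "g s \<in> carrier P" if "s \<in> Z" for s
      using that Z(2) supp(3)[OF f] gc by blast+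
    have "{s. (a \<odot>\<^bsub>?F\<^esub> f) s \<noteq> \<zero>\<^bsub>R\<^esub>} \<subseteq> Z" using a by (auto simp: Z_def)
    then have "lin_ext R P g (a \<odot>\<^bsub>?F\<^esub> f) = (\<Oplus>\<^bsub>P\<^esub>s\<in>Z. (a \<otimes>\<^bsub>R\<^esub> f s) \<odot>\<^bsub>P\<^esub> g s)"
      by (subst e[OF F.smult_closed[OF a f]]) simp_all
    also have "\<dots> = (\<Oplus>\<^bsub>P\<^esub>s\<in>Z. a \<odot>\<^bsub>P\<^esub> (f s \<odot>\<^bsub>P\<^esub> g s))"
      by (rule M.finsum_cong') (auto simp: smult_assoc1 fc gs a)
    also have "\<dots> = a \<odot>\<^bsub>P\<^esub> (\<Oplus>\<^bsub>P\<^esub>s\<in>Z. f s \<odot>\<^bsub>P\<^esub> g s)"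
      by (rule finsum_smult_ldistr[symmetric, OF Z(1) a]) (auto simp: fc gs)
    also have "(\<Oplus>\<^bsub>P\<^esub>s\<in>Z. f s \<odot>\<^bsub>P\<^esub> g s) = lin_ext R P g f"
      by (rule e[OF f, symmetric]) (auto simp: Z_def)
    finally show "lin_ext R P g (a \<odot>\<^bsub>?F\<^esub> f) = a \<odot>\<^bsub>P\<^esub> lin_ext R P g f" .
  qed
qed

lemma lin_ext_unit_vec:
  assumes "module R P" "g \<in> S \<rightarrow> carrier P" "s \<in> S"
  shows "lin_ext R P g (unit_vec R s) = g s"
proof -
  interpret module R P by fact
  have "lin_ext R P g (unit_vec R s) = (\<Oplus>\<^bsub>P\<^esub>t\<in>{s}. unit_vec R s t \<odot>\<^bsub>P\<^esub> g t)"
    by (rule lin_ext_eq[OF assms(1,2)]) (use assms unit_vec_carrier R.cring_axioms in \<open>auto simp: unit_vec_def\<close>)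
  also have "\<dots> = g s" using assms by (subst M.finsum_insert) (auto simp: unit_vec_def Pi_def)
  finally show ?thesis .
qed

lemma linear_mapsD:
  assumes "f \<in> linear_maps R M N"
  shows "x \<in> carrier M \<Longrightarrow> f x \<in> carrier N"
    "x \<in> carrier M \<Longrightarrow> y \<in> carrier M \<Longrightarrow> f (x \<oplus>\<^bsub>M\<^esub> y) = f x \<oplus>\<^bsub>N\<^esub> f y"
    "a \<in> carrier R \<Longrightarrow> x \<in> carrier M \<Longrightarrow> f (a \<odot>\<^bsub>M\<^esub> x) = a \<odot>\<^bsub>N\<^esub> f x"
  using assms by (auto simp: linear_maps_def)

lemma linear_maps_uminus:
  assumes "module R M" "module R N" "f \<in> linear_maps R M N"
  shows "f \<zero>\<^bsub>M\<^esub> = \<zero>\<^bsub>N\<^esub>" "x \<in> carrier M \<Longrightarrow> f (\<ominus>\<^bsub>M\<^esub> x) = \<ominus>\<^bsub>N\<^esub> f x"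
    "x \<in> carrier M \<Longrightarrow> y \<in> carrier M \<Longrightarrow> f (x \<ominus>\<^bsub>M\<^esub> y) = f x \<ominus>\<^bsub>N\<^esub> f y"
proof -
  interpret M: module R M by fact
  interpret N: module R N by fact
  note L = linear_mapsD[OF assms(3)]
  show 0: "f \<zero>\<^bsub>M\<^esub> = \<zero>\<^bsub>N\<^esub>"
    using L(3)[of "\<zero>\<^bsub>R\<^esub>" "\<zero>\<^bsub>M\<^esub>"] L(1)[of "\<zero>\<^bsub>M\<^esub>"] by simp
  show m: "f (\<ominus>\<^bsub>M\<^esub> x) = \<ominus>\<^bsub>N\<^esub> f x" if "x \<in> carrier M" for x
    using L(2)[of "\<ominus>\<^bsub>M\<^esub> x" x] that 0 L(1) by (metis M.M.a_inv_closed M.M.l_neg N.M.minus_equality)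
  show "f (x \<ominus>\<^bsub>M\<^esub> y) = f x \<ominus>\<^bsub>N\<^esub> f y" if "x \<in> carrier M" "y \<in> carrier M"
    using that by (simp add: a_minus_def L m)
qed

lemma eq_submodule:
  assumes "module R M" "module R N" "f \<in> linear_maps R M N" "g \<in> linear_maps R M N"
  shows "submodule {x \<in> carrier M. f x = g x} R M"
proof -
  interpret M: module R M by fact
  show ?thesis
    by (rule M.submoduleI)
      (auto simp: linear_mapsD[OF assms(3)] linear_mapsD[OF assms(4)]
        linear_maps_uminus[OF assms(1-3)] linear_maps_uminus[OF assms(1,2,4)])
qed

definition bilinear_maps ::
    "('a, 'r) ring_scheme \<Rightarrow> ('a, 'm, 'x) module_scheme \<Rightarrow> ('a, 'n, 'y) module_scheme
      \<Rightarrow> ('a, 'p, 'z) module_scheme \<Rightarrow> ('m \<Rightarrow> 'n \<Rightarrow> 'p) set"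
  where "bilinear_maps R M N P =
    {\<beta>. (\<forall>m\<in>carrier M. \<beta> m \<in> linear_maps R N P) \<and>
        (\<forall>n\<in>carrier N. (\<lambda>m. \<beta> m n) \<in> linear_maps R M P)}"

locale two_modules = M: module R M + N: module R N
  for R :: "('a, 'r) ring_scheme" and M :: "('a, 'm, 'x) module_scheme" and N :: "('a, 'n, 'y) module_scheme"
begin

abbreviation "F \<equiv> free_module R (carrier M \<times> carrier N)"
abbreviation "K \<equiv> tensor_ker R M N"
abbreviation "T \<equiv> tensor_module R M N"
abbreviation "pt \<equiv> pure_tensor R M N"

sublocale F: module R F by (rule free_module_module) (rule M.R.cring_axioms)

lemma uv: "m \<in> carrier M \<Longrightarrow> n \<in> carrier N \<Longrightarrow> unit_vec R (m, n) \<in> carrier F"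
  by (rule unit_vec_carrier) (auto intro: M.R.cring_axioms)

lemma rels_carrier: "tensor_rels R M N \<subseteq> carrier F"
  unfolding tensor_rels_def Let_def
  by (auto simp del: free_module_simps simp: uv)

lemma K: "submodule K R F"
  unfolding tensor_ker_def by (rule span_submodule[OF F.module_axioms rels_carrier])

sublocale K: abelian_subgroup K F by (rule submodule_abelian_subgroup[OF F.module_axioms K])

lemma module: "module R T"
  unfolding tensor_module_def by (rule quot_module_module[OF F.module_axioms K])

sublocale T: module R T by (rule module)

lemma T_simps: "carrier T = a_rcosets\<^bsub>F\<^esub> K" 
  unfolding tensor_module_def by simp

lemma class_carrier: "f \<in> carrier F \<Longrightarrow> K +>\<^bsub>F\<^esub> f \<in> carrier T"
  unfolding T_simps by (rule F.M.a_rcosetsI[OF K.a_subset])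

lemma class_add: "f \<in> carrier F \<Longrightarrow> g \<in> carrier F \<Longrightarrow>
    K +>\<^bsub>F\<^esub> (f \<oplus>\<^bsub>F\<^esub> g) = (K +>\<^bsub>F\<^esub> f) \<oplus>\<^bsub>T\<^esub> (K +>\<^bsub>F\<^esub> g)"
  unfolding tensor_module_def quot_module_simps by (rule K.a_rcos_sum[symmetric])

lemma class_smult: "a \<in> carrier R \<Longrightarrow> f \<in> carrier F \<Longrightarrow>
    K +>\<^bsub>F\<^esub> (a \<odot>\<^bsub>F\<^esub> f) = a \<odot>\<^bsub>T\<^esub> (K +>\<^bsub>F\<^esub> f)"
  unfolding tensor_module_def by (rule quot_smult[OF F.module_axioms K, symmetric])

lemma class_linear: "(\<lambda>f. K +>\<^bsub>F\<^esub> f) \<in> linear_maps R F T"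
  unfolding linear_maps_def using class_carrier class_add class_smult by blast

lemma class_eq: "f \<in> carrier F \<Longrightarrow> g \<in> carrier F \<Longrightarrow> f \<ominus>\<^bsub>F\<^esub> g \<in> K \<Longrightarrow> K +>\<^bsub>F\<^esub> f = K +>\<^bsub>F\<^esub> g"
  unfolding a_minus_def
  by (metis K.a_rcos_module K.a_repr_independence')

lemma relD: "r \<in> tensor_rels R M N \<Longrightarrow> r \<in> K"
  unfolding tensor_ker_def by (rule span_superset)

lemma pt_closed: "m \<in> carrier M \<Longrightarrow> n \<in> carrier N \<Longrightarrow> pt m n \<in> carrier T"
  unfolding pure_tensor_def by (intro class_carrier uv)

lemma pt_add_l:
  assumes "m \<in> carrier M" "m' \<in> carrier M" "n \<in> carrier N"
  shows "pt (m \<oplus>\<^bsub>M\<^esub> m') n = pt m n \<oplus>\<^bsub>T\<^esub> pt m' n"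
proof -
  have "unit_vec R (m \<oplus>\<^bsub>M\<^esub> m', n) \<ominus>\<^bsub>F\<^esub> (unit_vec R (m, n) \<oplus>\<^bsub>F\<^esub> unit_vec R (m', n)) \<in> K"
    by (rule relD) (use assms in \<open>unfold tensor_rels_def Let_def, blast\<close>)
  then show ?thesis unfolding pure_tensor_def
    using assms by (subst class_add[symmetric]) (simp_all add: uv class_eq del: free_module_simps)
qed

lemma pt_add_r:
  assumes "m \<in> carrier M" "n \<in> carrier N" "n' \<in> carrier N"
  shows "pt m (n \<oplus>\<^bsub>N\<^esub> n') = pt m n \<oplus>\<^bsub>T\<^esub> pt m n'"
proof -
  have "unit_vec R (m, n \<oplus>\<^bsub>N\<^esub> n') \<ominus>\<^bsub>F\<^esub> (unit_vec R (m, n) \<oplus>\<^bsub>F\<^esub> unit_vec R (m, n')) \<in> K"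
    by (rule relD) (use assms in \<open>unfold tensor_rels_def Let_def, blast\<close>)
  then show ?thesis unfolding pure_tensor_def
    using assms by (subst class_add[symmetric]) (simp_all add: uv class_eq del: free_module_simps)
qed

lemma pt_smult_l:
  assumes "a \<in> carrier R" "m \<in> carrier M" "n \<in> carrier N"
  shows "pt (a \<odot>\<^bsub>M\<^esub> m) n = a \<odot>\<^bsub>T\<^esub> pt m n"
proof -
  have "unit_vec R (a \<odot>\<^bsub>M\<^esub> m, n) \<ominus>\<^bsub>F\<^esub> (a \<odot>\<^bsub>F\<^esub> unit_vec R (m, n)) \<in> K"
    by (rule relD) (use assms in \<open>unfold tensor_rels_def Let_def, blast\<close>)
  then show ?thesis unfolding pure_tensor_def
    using assms by (subst class_smult[symmetric]) (simp_all add: uv class_eq del: free_module_simps)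
qed

lemma pt_smult_r:
  assumes "a \<in> carrier R" "m \<in> carrier M" "n \<in> carrier N"
  shows "pt m (a \<odot>\<^bsub>N\<^esub> n) = a \<odot>\<^bsub>T\<^esub> pt m n"
proof -
  have "unit_vec R (m, a \<odot>\<^bsub>N\<^esub> n) \<ominus>\<^bsub>F\<^esub> (a \<odot>\<^bsub>F\<^esub> unit_vec R (m, n)) \<in> K"
    by (rule relD) (use assms in \<open>unfold tensor_rels_def Let_def, blast\<close>)
  then show ?thesis unfolding pure_tensor_def
    using assms by (subst class_smult[symmetric]) (simp_all add: uv class_eq del: free_module_simps)
qed

lemma pt_bilinear: "pt \<in> bilinear_maps R M N T"
  by (auto simp: bilinear_maps_def linear_maps_def pt_closed pt_add_l pt_add_r pt_smult_l pt_smult_r)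

lemma tensor_lift_class:
  assumes "module R P" "\<beta> \<in> bilinear_maps R M N P" "f \<in> carrier F"
  shows "tensor_lift R P \<beta> (K +>\<^bsub>F\<^esub> f) = lin_ext R P (\<lambda>(m, n). \<beta> m n) f"
proof -
  interpret P: module R P by fact
  let ?g = "\<lambda>(m, n). \<beta> m n"
  let ?L = "lin_ext R P ?g"
  have g: "?g \<in> carrier M \<times> carrier N \<rightarrow> carrier P"
    using assms(2) by (auto simp: bilinear_maps_def linear_maps_def)
  note L = lin_ext_linear[OF P.module_axioms g]
  note u = lin_ext_unit_vec[OF P.module_axioms g]
  have Z: "(\<lambda>_. \<zero>\<^bsub>P\<^esub>) \<in> linear_maps R F P" by (auto simp: linear_maps_def)
  have b: "m \<in> carrier M \<Longrightarrow> \<beta> m \<in> linear_maps R N P"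
      "n \<in> carrier N \<Longrightarrow> (\<lambda>m. \<beta> m n) \<in> linear_maps R M P" for m n
    using assms(2) by (auto simp: bilinear_maps_def)
  note bl = linear_mapsD[OF b(1)] linear_mapsD[OF b(2)]
  have "?L r = \<zero>\<^bsub>P\<^esub>" if "r \<in> tensor_rels R M N" for r
    using that unfolding tensor_rels_def Let_def
    by (elim UnE CollectE exE conjE; simp only:)
      (simp_all del: free_module_simps
        add: linear_maps_uminus[OF F.module_axioms P.module_axioms L] linear_mapsD[OF L] uv u bl P.M.r_neg a_minus_def)
  then have "tensor_rels R M N \<subseteq> {x \<in> carrier F. ?L x = \<zero>\<^bsub>P\<^esub>}" using rels_carrier by auto
  then have KL: "K \<subseteq> {x \<in> carrier F. ?L x = \<zero>\<^bsub>P\<^esub>}" unfolding tensor_ker_def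
    by (rule span_least[OF eq_submodule[OF F.module_axioms P.module_axioms L Z]])
  have "(SOME x. x \<in> K +>\<^bsub>F\<^esub> f) \<in> K +>\<^bsub>F\<^esub> f"
    using K.a_rcos_self[OF assms(3)] by (rule someI[where P = "\<lambda>x. x \<in> K +>\<^bsub>F\<^esub> f"])
  then obtain k where k: "k \<in> K" "(SOME x. x \<in> K +>\<^bsub>F\<^esub> f) = k \<oplus>\<^bsub>F\<^esub> f"
    unfolding a_r_coset_def' by blast
  then have kF: "k \<in> carrier F" and k0: "?L k = \<zero>\<^bsub>P\<^esub>" using KL by auto
  show ?thesis unfolding tensor_lift_def k(2)
    using linear_mapsD[OF L] kF assms(3) k0 by (simp del: free_module_simps)
qed

lemma tensor_lift_linear:
  assumes "module R P" "\<beta> \<in> bilinear_maps R M N P"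
  shows "tensor_lift R P \<beta> \<in> linear_maps R T P"
proof -
  have g: "(\<lambda>(m, n). \<beta> m n) \<in> carrier M \<times> carrier N \<rightarrow> carrier P"
    using assms(2) by (auto simp: bilinear_maps_def linear_maps_def)
  note L = linear_mapsD[OF lin_ext_linear[OF assms(1) g]]
  note c = tensor_lift_class[OF assms]
  have E: "\<exists>f\<in>carrier F. t = K +>\<^bsub>F\<^esub> f" if "t \<in> carrier T" for t
    using that unfolding T_simps by (auto simp: A_RCOSETS_def')
  show ?thesis unfolding linear_maps_def
    by (auto dest!: E simp: c L class_add[symmetric] class_smult[symmetric] simp del: free_module_simps)
qed

lemma tensor_lift_pt:
  assumes "module R P" "\<beta> \<in> bilinear_maps R M N P" "m \<in> carrier M" "n \<in> carrier N"
  shows "tensor_lift R P \<beta> (pt m n) = \<beta> m n"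
proof -
  have g: "(\<lambda>(m, n). \<beta> m n) \<in> carrier M \<times> carrier N \<rightarrow> carrier P"
    using assms(2) by (auto simp: bilinear_maps_def linear_maps_def)
  show ?thesis unfolding pure_tensor_def tensor_lift_class[OF assms(1,2) uv[OF assms(3,4)]]
    by (subst lin_ext_unit_vec[OF assms(1) g]) (use assms in auto)
qed

end

lemma cring_transfer:
  assumes "cring R" "carrier S = carrier R"
    "\<And>x y. x \<in> carrier R \<Longrightarrow> y \<in> carrier R \<Longrightarrow> x \<otimes>\<^bsub>S\<^esub> y = x \<otimes>\<^bsub>R\<^esub> y"
    "\<And>x y. x \<in> carrier R \<Longrightarrow> y \<in> carrier R \<Longrightarrow> x \<oplus>\<^bsub>S\<^esub> y = x \<oplus>\<^bsub>R\<^esub> y"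
    "\<one>\<^bsub>S\<^esub> = \<one>\<^bsub>R\<^esub>" "\<zero>\<^bsub>S\<^esub> = \<zero>\<^bsub>R\<^esub>"
  shows "cring S"
proof -
  interpret cring R by fact
  have "abelian_group S"
    by (rule abelian_groupI) (use assms l_neg a_inv_closed in \<open>auto simp: a_ac intro!: bexI[of _ "\<ominus>\<^bsub>R\<^esub> _"]\<close>)
  moreover have "Group.comm_monoid S"
    by (rule comm_monoidI) (use assms in \<open>auto simp: m_ac\<close>)
  ultimately show ?thesis
    by (rule cringI) (use assms in \<open>auto simp: l_distr\<close>)
qed

lemma hom_algebra:
  assumes "cring R" "cring S" "h \<in> ring_hom R S"
  shows "algebra R (ring.extend (ring.truncate S) (module.fields (\<lambda>a p. h a \<otimes>\<^bsub>S\<^esub> p)))" (is "algebra R ?S")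
proof -
  interpret R: cring R by fact
  interpret S: cring S by fact
  note h = ring_hom_closed[OF assms(3)] ring_hom_mult[OF assms(3)] ring_hom_add[OF assms(3)] ring_hom_one[OF assms(3)]
  have c: "cring ?S"
    by (rule cring_transfer[OF assms(2)]) (simp_all add: ring.defs module.defs)
  show ?thesis
    by (rule algebraI[OF assms(1) c])
      (auto simp: ring.defs module.defs h S.l_distr S.r_distr S.m_assoc)
qed

lemma up_const_hom: "cring S \<Longrightarrow> up_const S \<in> ring_hom S (UP S)"
proof -
  assume "cring S"
  then interpret UP_cring S "UP S" by (auto simp: UP_cring_def)
  show ?thesis by (rule ring_hom_memI) (auto simp: up_const_def monom_mult_is_smult[symmetric] monom_mult[of _ _ 0 0, simplified])
qed

lemma UP_cring': "cring S \<Longrightarrow> cring (UP S)"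
  by (intro UP_cring.UP_cring) (simp add: UP_cring_def)

lemma poly_const_hom:
  assumes "cring A" shows "poly_const A \<in> ring_hom A (UP (UP (UP (UP (UP A)))))"
proof -
  note u = UP_cring'
  note t = ring_hom_trans
  have "poly_const A = up_const (UP (UP (UP (UP A)))) \<circ> (up_const (UP (UP (UP A))) \<circ> (up_const (UP (UP A))
      \<circ> (up_const (UP A) \<circ> up_const A)))" by (simp add: poly_const_def fun_eq_iff)
  then show ?thesis using assms
    by (auto intro!: t up_const_hom u)
qed

lemma poly_alg_algebra: "cring A \<Longrightarrow> algebra A (poly_alg A)"
  unfolding poly_alg_def Let_def by (intro hom_algebra poly_const_hom UP_cring')

lemma quot_alg_algebra:
  assumes "algebra R C" "ideal I C" shows "algebra R (quot_alg C I)"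
proof -
  interpret algebra R C by fact
  interpret I: ideal I C by fact
  interpret I: abelian_subgroup I C by (rule abelian_subgroupI3) (auto intro: I.additive_subgroup_axioms M.abelian_group_axioms)
  have sub: "submodule I R C"
  proof (rule submoduleI)
    fix a x assume "a \<in> carrier R" "x \<in> I"
    then have "a \<odot>\<^bsub>C\<^esub> x = (a \<odot>\<^bsub>C\<^esub> \<one>\<^bsub>C\<^esub>) \<otimes>\<^bsub>C\<^esub> x" using smult_assoc2[of a "\<one>\<^bsub>C\<^esub>" x] by (simp add: I.a_Hcarr)
    then show "a \<odot>\<^bsub>C\<^esub> x \<in> I" using \<open>x \<in> I\<close> \<open>a \<in> carrier R\<close> by (simp add: I.I_l_closed)
  qed (auto simp: I.a_Hcarr)
  have q: "carrier (quot_alg C I) = carrier (quot_module C I)" "add (quot_alg C I) = add (quot_module C I)"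
    "zero (quot_alg C I) = zero (quot_module C I)" "smult (quot_alg C I) = smult (quot_module C I)"
    by (simp_all add: quot_alg_def FactRing_def ring.defs module.defs)
  have m: "x \<otimes>\<^bsub>quot_alg C I\<^esub> y = rcoset_mult C I x y" for x y
    by (simp add: quot_alg_def FactRing_def ring.defs module.defs)
  interpret Q: module R "quot_module C I" by (rule quot_module_module[OF module_axioms sub])
  have cr: "cring (C Quot I)" by (rule I.quotient_is_cring) (rule is_cring)
  have c: "cring (quot_alg C I)"
    by (rule cring_transfer[OF cr]) (simp_all add: quot_alg_def ring.defs module.defs)
  have cc: "I +>\<^bsub>C\<^esub> m \<in> carrier (quot_module C I)" if "m \<in> carrier C" for m
    using that by (auto simp: A_RCOSETS_def')
  show ?thesis
  proof (rule algebraI[OF R.cring_axioms c], unfold q)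
    fix a X Y assume a: "a \<in> carrier R" and "X \<in> carrier (quot_module C I)" "Y \<in> carrier (quot_module C I)"
    then obtain x y where "x \<in> carrier C" "y \<in> carrier C" "X = I +>\<^bsub>C\<^esub> x" "Y = I +>\<^bsub>C\<^esub> y"
      by (elim quot_carrierE) blast
    with a show "(a \<odot>\<^bsub>quot_module C I\<^esub> X) \<otimes>\<^bsub>quot_alg C I\<^esub> Y = a \<odot>\<^bsub>quot_module C I\<^esub> (X \<otimes>\<^bsub>quot_alg C I\<^esub> Y)"
      unfolding m by (simp add: I.rcoset_mult_add quot_smult[OF module_axioms sub] smult_assoc2 del: quot_module_simps)
  qed (auto simp: Q.smult_l_distr Q.smult_r_distr Q.smult_assoc1 simp del: quot_module_simps)
qed

lemma up_carrier:
  assumes "cring S"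
  shows "a \<in> carrier S \<Longrightarrow> up_const S a \<in> carrier (UP S)" "up_var S \<in> carrier (UP S)"
proof -
  interpret UP_cring S "UP S" using assms by (auto simp: UP_cring_def)
  show "a \<in> carrier S \<Longrightarrow> up_const S a \<in> carrier (UP S)" "up_var S \<in> carrier (UP S)"
    by (auto simp: up_const_def up_var_def)
qed

lemma poly_alg_carrier: "carrier (poly_alg A) = carrier (UP (UP (UP (UP (UP A)))))"
  by (simp add: poly_alg_def Let_def ring.defs module.defs)

lemma poly_x_carrier: "cring A \<Longrightarrow> poly_x A i j \<in> carrier (poly_alg A)"
  and poly_t_carrier: "cring A \<Longrightarrow> poly_t A \<in> carrier (poly_alg A)"
  unfolding poly_alg_carrier poly_x_def poly_t_def by (auto intro!: up_carrier UP_cring')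

lemma det_ideal_ideal: assumes "cring A" shows "ideal (det_ideal A) (poly_alg A)"
proof -
  interpret algebra A "poly_alg A" by (rule poly_alg_algebra) fact
  show ?thesis unfolding det_ideal_def Let_def
    by (rule ring.genideal_ideal[OF cring.axioms(1)[OF M_cring]]) (simp add: poly_x_carrier poly_t_carrier assms M.minus_closed)
qed

lemma kG_algebra: "cring A \<Longrightarrow> algebra A (kG A)"
  unfolding kG_def by (intro quot_alg_algebra poly_alg_algebra det_ideal_ideal)

lemma kG_x_carrier: "cring A \<Longrightarrow> kG_x A i j \<in> carrier (kG A)"
  using poly_x_carrier[of A i j]
  by (auto simp: kG_x_def kG_def quot_alg_def ring.defs module.defs FactRing_def A_RCOSETS_def')

lemma ideals:
  assumes "cring A"
  shows "ideal (ideal_I1 A) (kG A)" "ideal (ideal_I2 A) (kG A)"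
    "ideal (ideal_I1 A \<cdot>\<^bsub>kG A\<^esub> ideal_I2 A) (kG A)"
proof -
  interpret algebra A "kG A" by (rule kG_algebra) fact
  show *: "ideal (ideal_I1 A) (kG A)" "ideal (ideal_I2 A) (kG A)"
    unfolding ideal_I1_def ideal_I2_def by (rule ring.genideal_ideal[OF cring.axioms(1)[OF M_cring]], simp add: kG_x_carrier assms)+
  show "ideal (ideal_I1 A \<cdot>\<^bsub>kG A\<^esub> ideal_I2 A) (kG A)"
    by (rule ring.ideal_prod_is_ideal[OF cring.axioms(1)[OF M_cring] *])
qed

lemma kN_algebra: "cring A \<Longrightarrow> algebra A (kN A)" and kT_algebra: "cring A \<Longrightarrow> algebra A (kT A)"
  unfolding kN_def kT_def by (intro quot_alg_algebra kG_algebra ideals; assumption)+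

lemma free_module_ext:
  assumes "module R P" "f \<in> linear_maps R (free_module R S) P" "g \<in> linear_maps R (free_module R S) P"
    "\<And>s. s \<in> S \<Longrightarrow> f (unit_vec R s) = g (unit_vec R s)" "v \<in> carrier (free_module R S)"
  shows "f v = g v"
proof -
  interpret P: module R P by fact
  let ?F = "free_module R S"
  interpret F: module R ?F by (rule free_module_module) (rule P.R.cring_axioms)
  have "v \<in> carrier ?F \<Longrightarrow> {s. v s \<noteq> \<zero>\<^bsub>R\<^esub>} \<subseteq> T \<Longrightarrow> f v = g v" if "finite T" "T \<subseteq> S" for T v
    using that
  proof (induction T arbitrary: v)
    case empty
    then have "v = \<zero>\<^bsub>?F\<^esub>" by (auto simp: fun_eq_iff)
    then show ?case using linear_maps_uminus(1)[OF F.module_axioms assms(1,2)] linear_maps_uminus(1)[OF F.module_axioms assms(1,3)] by simp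
  next
    case (insert t T)
    let ?w = "v(t := \<zero>\<^bsub>R\<^esub>)"
    have "finite {s. ?w s \<noteq> \<zero>\<^bsub>R\<^esub>}"
      by (rule finite_subset[of _ "{s. v s \<noteq> \<zero>\<^bsub>R\<^esub>}"]) (use insert.prems in auto)
    then have w: "?w \<in> carrier ?F" using insert.prems by auto
    have tv: "v t \<in> carrier R" using insert.prems by auto
    have vc: "v s \<in> carrier R" for s using insert.prems(1) by (cases "s \<in> S") auto
    have u: "unit_vec R t \<in> carrier ?F" using insert.prems by (intro unit_vec_carrier P.R.cring_axioms) auto
    have e: "v = ?w \<oplus>\<^bsub>?F\<^esub> (v t \<odot>\<^bsub>?F\<^esub> unit_vec R t)"
      using vc by (auto simp: fun_eq_iff unit_vec_def)
    have IH: "f ?w = g ?w" by (rule insert.IH[OF w]) (use insert.prems in auto)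
    note L = linear_mapsD[OF assms(2)] linear_mapsD[OF assms(3)]
    have tu: "v t \<odot>\<^bsub>?F\<^esub> unit_vec R t \<in> carrier ?F" by (rule F.smult_closed[OF tv u])
    have "f v = f ?w \<oplus>\<^bsub>P\<^esub> v t \<odot>\<^bsub>P\<^esub> f (unit_vec R t)"
      by (subst e) (simp only: L(2)[OF w tu] L(3)[OF tv u])
    moreover have "g v = g ?w \<oplus>\<^bsub>P\<^esub> v t \<odot>\<^bsub>P\<^esub> g (unit_vec R t)"
      by (subst e) (simp only: L(5)[OF w tu] L(6)[OF tv u])
    ultimately show ?case using IH assms(4)[of t] insert.prems by auto
  qed
  from this[of "{s. v s \<noteq> \<zero>\<^bsub>R\<^esub>}" v] show ?thesis using assms(5) by auto
qed

context two_modules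
begin

lemma tensor_ext:
  assumes "module R P" "f \<in> linear_maps R T P" "g \<in> linear_maps R T P"
    "\<And>m n. m \<in> carrier M \<Longrightarrow> n \<in> carrier N \<Longrightarrow> f (pt m n) = g (pt m n)" "t \<in> carrier T"
  shows "f t = g t"
proof -
  obtain v where v: "v \<in> carrier F" "t = K +>\<^bsub>F\<^esub> v" using assms(5) unfolding T_simps by (auto simp: A_RCOSETS_def')
  have c: "(\<lambda>v. h (K +>\<^bsub>F\<^esub> v)) \<in> linear_maps R F P" if "h \<in> linear_maps R T P" for h
    using linear_mapsD[OF that] linear_mapsD[OF class_linear] by (auto simp: linear_maps_def simp del: free_module_simps)
  have "(\<lambda>v. f (K +>\<^bsub>F\<^esub> v)) v = (\<lambda>v. g (K +>\<^bsub>F\<^esub> v)) v"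
    by (rule free_module_ext[OF assms(1) c[OF assms(2)] c[OF assms(3)] _ v(1)])
      (use assms(4) in \<open>auto simp: pure_tensor_def\<close>)
  then show ?thesis using v by simp
qed

end

lemma linear_maps_comp: "f \<in> linear_maps R M N \<Longrightarrow> g \<in> linear_maps R N P \<Longrightarrow> (\<lambda>x. g (f x)) \<in> linear_maps R M P"
  by (auto simp: linear_maps_def Pi_iff)

lemma linear_maps_id: "(\<lambda>x. x) \<in> linear_maps R M M" "id \<in> linear_maps R M M"
  by (auto simp: linear_maps_def)

lemma tensor_map:
  assumes "module R M" "module R N" "module R K" "module R L"
    "f \<in> linear_maps R M K" "g \<in> linear_maps R N L"
  shows "tensor_map R K L f g \<in> linear_maps R (tensor_module R M N) (tensor_module R K L)"
    and "m \<in> carrier M \<Longrightarrow> n \<in> carrier N \<Longrightarrow>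
      tensor_map R K L f g (pure_tensor R M N m n) = pure_tensor R K L (f m) (g n)"
proof -
  interpret two_modules R M N by (intro two_modules.intro assms)
  interpret KL: two_modules R K L by (intro two_modules.intro assms)
  have b: "(\<lambda>m n. KL.pt (f m) (g n)) \<in> bilinear_maps R M N KL.T"
    using linear_mapsD[OF assms(5)] linear_mapsD[OF assms(6)]
    by (auto simp: bilinear_maps_def linear_maps_def KL.pt_closed KL.pt_add_l KL.pt_add_r KL.pt_smult_l KL.pt_smult_r)
  show "tensor_map R K L f g \<in> linear_maps R T KL.T"
    unfolding tensor_map_def by (rule tensor_lift_linear[OF KL.module b])
  show "m \<in> carrier M \<Longrightarrow> n \<in> carrier N \<Longrightarrow> tensor_map R K L f g (pt m n) = KL.pt (f m) (g n)"
    unfolding tensor_map_def by (rule tensor_lift_pt[OF KL.module b])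
qed

lemma std_simps:
  "carrier (std_comod A) = carrier (std_module A)" "zero (std_comod A) = zero (std_module A)"
  "add (std_comod A) = add (std_module A)" "smult (std_comod A) = smult (std_module A)"
  "coact (std_comod A) = lin_ext A (tensor_module A (std_module A) (kG A))
        (\<lambda>j. \<Oplus>\<^bsub>tensor_module A (std_module A) (kG A)\<^esub>i\<in>{1, 2}. pure_tensor A (std_module A) (kG A) (unit_vec A i) (kG_x A i j))"
  by (simp_all add: std_comod_def Let_def module.defs comod.defs)

lemma module_transfer:
  assumes "module R M" "carrier N = carrier M" "zero N = zero M" "add N = add M" "smult N = smult M"
  shows "module R N"
proof -
  interpret module R M by fact
  have "abelian_group N"
    by (rule abelian_groupI) (use assms M.l_neg M.a_inv_closed in \<open>auto simp: M.a_ac intro!: bexI[of _ "\<ominus>\<^bsub>M\<^esub> _"]\<close>)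
  then show ?thesis
    by (intro moduleI) (use assms in \<open>auto simp: R.cring_axioms smult_l_distr smult_r_distr smult_assoc1\<close>)
qed

lemma std_module: "cring A \<Longrightarrow> module A (std_comod A)"
  by (rule module_transfer[OF free_module_module[of A "{1, 2::nat}"]]) (simp_all add: std_simps std_module_def)

lemma tensor_module_cong:
  assumes "carrier M' = carrier M" "add M' = add M" "smult M' = smult M"
    "carrier N' = carrier N" "add N' = add N" "smult N' = smult N"
  shows "tensor_module R M' N' = tensor_module R M N" "pure_tensor R M' N' = pure_tensor R M N"
  using assms by (simp_all add: tensor_module_def pure_tensor_def[abs_def] tensor_ker_def tensor_rels_def)

lemma tensor_std: "tensor_module A (std_module A) C = tensor_module A (std_comod A) C"
    "pure_tensor A (std_module A) C = pure_tensor A (std_comod A) C"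
  by (rule tensor_module_cong; simp add: std_simps)+

lemma std_coact:
  assumes "cring A"
  defines "P \<equiv> tensor_module A (std_comod A) (kG A)"
  shows "coact (std_comod A) \<in> linear_maps A (std_comod A) P"
    and "j \<in> {1, 2} \<Longrightarrow> coact (std_comod A) (unit_vec A j) =
      pure_tensor A (std_comod A) (kG A) (unit_vec A 1) (kG_x A 1 j)
      \<oplus>\<^bsub>P\<^esub> pure_tensor A (std_comod A) (kG A) (unit_vec A 2) (kG_x A 2 j)"
proof -
  interpret kG: algebra A "kG A" by (rule kG_algebra) fact
  interpret two_modules A "std_comod A" "kG A"
    by (intro two_modules.intro std_module assms kG.module_axioms)
  have u: "unit_vec A i \<in> carrier (std_comod A)" if "i \<in> {1, 2}" for i
    unfolding std_simps std_module_def by (rule unit_vec_carrier[OF assms(1) that])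
  have pc: "pt (unit_vec A i) (kG_x A i j) \<in> carrier T" if "i \<in> {1, 2}" for i j
    by (intro pt_closed u that kG_x_carrier assms)
  let ?g = "\<lambda>j. \<Oplus>\<^bsub>T\<^esub>i\<in>{1, 2}. pt (unit_vec A i) (kG_x A i j)"
  have g: "?g \<in> {1, 2::nat} \<rightarrow> carrier T" using pc by (auto intro!: T.M.finsum_closed)
  have c: "coact (std_comod A) = lin_ext A T ?g" by (simp add: std_simps tensor_std)
  note L = lin_ext_linear[OF T.module_axioms g] lin_ext_unit_vec[OF T.module_axioms g]
  show "coact (std_comod A) \<in> linear_maps A (std_comod A) P"
    using L(1) unfolding c P_def by (simp add: linear_maps_def std_simps std_module_def)
  show "coact (std_comod A) (unit_vec A j) = pt (unit_vec A 1) (kG_x A 1 j)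
      \<oplus>\<^bsub>P\<^esub> pt (unit_vec A 2) (kG_x A 2 j)" if "j \<in> {1, 2}"
    unfolding c L(2)[OF that] P_def using pc by (subst T.M.finsum_insert) auto
qed

locale coact_tensor = C: algebra R C + M: module R M + N: module R N
  for R :: "('a, 'r) ring_scheme" and C :: "('a, 'c, 'z) module_scheme"
    and M :: "('a, 'm, 'c, 'x) comod_scheme" and N :: "('a, 'n, 'c, 'y) comod_scheme" +
  assumes coact_M: "coact M \<in> linear_maps R M (tensor_module R M C)"
    and coact_N: "coact N \<in> linear_maps R N (tensor_module R N C)"
begin

abbreviation "MN \<equiv> tensor_module R M N"
abbreviation "P \<equiv> tensor_module R MN C"

sublocale MC: two_modules R M C by (intro two_modules.intro M.module_axioms C.module_axioms)
sublocale NC: two_modules R N C by (intro two_modules.intro N.module_axioms C.module_axioms)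
sublocale MN: two_modules R M N by (intro two_modules.intro M.module_axioms N.module_axioms)
sublocale P: two_modules R MN C by (intro two_modules.intro MN.module C.module_axioms)

abbreviation "inner m c \<equiv> (\<lambda>n d. P.pt (MN.pt m n) (c \<otimes>\<^bsub>C\<^esub> d))"

lemma C_ring:
  "x \<in> carrier C \<Longrightarrow> y \<in> carrier C \<Longrightarrow> x \<otimes>\<^bsub>C\<^esub> y \<in> carrier C"
  "x \<in> carrier C \<Longrightarrow> y \<in> carrier C \<Longrightarrow> x \<otimes>\<^bsub>C\<^esub> y = y \<otimes>\<^bsub>C\<^esub> x"
  "x \<in> carrier C \<Longrightarrow> y \<in> carrier C \<Longrightarrow> z \<in> carrier C \<Longrightarrow>
    x \<otimes>\<^bsub>C\<^esub> (y \<oplus>\<^bsub>C\<^esub> z) = x \<otimes>\<^bsub>C\<^esub> y \<oplus>\<^bsub>C\<^esub> x \<otimes>\<^bsub>C\<^esub> z"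
  "x \<in> carrier C \<Longrightarrow> y \<in> carrier C \<Longrightarrow> z \<in> carrier C \<Longrightarrow>
    (x \<oplus>\<^bsub>C\<^esub> y) \<otimes>\<^bsub>C\<^esub> z = x \<otimes>\<^bsub>C\<^esub> z \<oplus>\<^bsub>C\<^esub> y \<otimes>\<^bsub>C\<^esub> z"
  using C.M_cring by (auto simp: cring.cring_simprules)

lemma C_comm: "a \<in> carrier R \<Longrightarrow> x \<in> carrier C \<Longrightarrow> y \<in> carrier C \<Longrightarrow>
   x \<otimes>\<^bsub>C\<^esub> (a \<odot>\<^bsub>C\<^esub> y) = a \<odot>\<^bsub>C\<^esub> (x \<otimes>\<^bsub>C\<^esub> y)"
  by (metis C_ring(2) C.smult_assoc2 C.smult_closed)

lemmas pts = MN.pt_closed MN.pt_add_l MN.pt_add_r MN.pt_smult_l MN.pt_smult_r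
  P.pt_closed P.pt_add_l P.pt_add_r P.pt_smult_l P.pt_smult_r

lemma inner: "m \<in> carrier M \<Longrightarrow> c \<in> carrier C \<Longrightarrow> inner m c \<in> bilinear_maps R N C P"
  by (auto simp: bilinear_maps_def linear_maps_def pts C_ring(1,3,4) C_comm)

lemma inner_lift: "m \<in> carrier M \<Longrightarrow> c \<in> carrier C \<Longrightarrow>
    tensor_lift R P (inner m c) \<in> linear_maps R NC.T P"
  by (intro NC.tensor_lift_linear inner P.module)

lemma inner_pt: "m \<in> carrier M \<Longrightarrow> c \<in> carrier C \<Longrightarrow> n \<in> carrier N \<Longrightarrow> d \<in> carrier C \<Longrightarrow>
    tensor_lift R P (inner m c) (NC.pt n d) = P.pt (MN.pt m n) (c \<otimes>\<^bsub>C\<^esub> d)"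
  by (intro NC.tensor_lift_pt inner P.module)

lemma sum_linear: "f \<in> linear_maps R NC.T P \<Longrightarrow> g \<in> linear_maps R NC.T P \<Longrightarrow> (\<lambda>t. f t \<oplus>\<^bsub>P\<^esub> g t) \<in> linear_maps R NC.T P"
  by (auto simp: linear_maps_def Pi_iff P.T.smult_r_distr P.T.M.a_ac)

lemma smult_linear: "f \<in> linear_maps R NC.T P \<Longrightarrow> a \<in> carrier R \<Longrightarrow> (\<lambda>t. a \<odot>\<^bsub>P\<^esub> f t) \<in> linear_maps R NC.T P"
  by (auto simp: linear_maps_def Pi_iff P.T.smult_r_distr P.T.smult_assoc1[symmetric] C.R.m_comm)

lemma outer: assumes t: "t \<in> carrier NC.T"
  shows "(\<lambda>m c. tensor_lift R P (inner m c) t) \<in> bilinear_maps R M C P"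
proof -
  note L = linear_mapsD[OF inner_lift]
  note E = NC.tensor_ext[OF P.module _ _ _ t]
  have 1: "tensor_lift R P (inner (m \<oplus>\<^bsub>M\<^esub> m') c) t = tensor_lift R P (inner m c) t \<oplus>\<^bsub>P\<^esub> tensor_lift R P (inner m' c) t"
    if "m \<in> carrier M" "m' \<in> carrier M" "c \<in> carrier C" for m m' c
    by (rule E, intro inner_lift sum_linear, use that in simp, use that in simp, intro sum_linear inner_lift)
      (use that in \<open>simp_all add: inner_pt pts C_ring(1)\<close>)
  have 2: "tensor_lift R P (inner m (c \<oplus>\<^bsub>C\<^esub> c')) t = tensor_lift R P (inner m c) t \<oplus>\<^bsub>P\<^esub> tensor_lift R P (inner m c') t"
    if "m \<in> carrier M" "c' \<in> carrier C" "c \<in> carrier C" for m c c'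
    by (rule E, intro inner_lift sum_linear, use that in simp, use that in simp, intro sum_linear inner_lift)
      (use that in \<open>simp_all add: inner_pt pts C_ring(1,3,4)\<close>)
  have 3: "tensor_lift R P (inner (a \<odot>\<^bsub>M\<^esub> m) c) t = a \<odot>\<^bsub>P\<^esub> tensor_lift R P (inner m c) t"
    if "m \<in> carrier M" "a \<in> carrier R" "c \<in> carrier C" for m a c
    by (rule E, intro inner_lift, use that in simp, use that in simp, intro smult_linear inner_lift)
      (use that in \<open>simp_all add: inner_pt pts C_ring(1)\<close>)
  have 4: "tensor_lift R P (inner m (a \<odot>\<^bsub>C\<^esub> c)) t = a \<odot>\<^bsub>P\<^esub> tensor_lift R P (inner m c) t"
    if "m \<in> carrier M" "a \<in> carrier R" "c \<in> carrier C" for m a c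
    by (rule E, intro inner_lift, use that in simp, use that in simp, intro smult_linear inner_lift)
      (use that in \<open>simp_all add: inner_pt pts C_ring(1) C.smult_assoc2\<close>)
  show ?thesis
    using 1 2 3 4 L t by (auto simp: bilinear_maps_def linear_maps_def)
qed

lemma coact_mult_pt:
  assumes "m \<in> carrier M" "c \<in> carrier C" "n \<in> carrier N" "d \<in> carrier C"
  shows "coact_mult R C M N (MC.pt m c) (NC.pt n d) = P.pt (MN.pt m n) (c \<otimes>\<^bsub>C\<^esub> d)"
  unfolding coact_mult_def Let_def
  by (subst MC.tensor_lift_pt[OF P.module outer]) (use assms NC.pt_closed inner_pt in auto)

lemma coact_mult_bilinear: "coact_mult R C M N \<in> bilinear_maps R MC.T NC.T P"
proof -
  have l: "(\<lambda>s. coact_mult R C M N s t) \<in> linear_maps R MC.T P" if "t \<in> carrier NC.T" for t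
    unfolding coact_mult_def Let_def by (rule MC.tensor_lift_linear[OF P.module outer[OF that]])
  note ld = linear_mapsD[OF l]
  have pt: "coact_mult R C M N (MC.pt m c) t = tensor_lift R P (inner m c) t"
    if "m \<in> carrier M" "c \<in> carrier C" "t \<in> carrier NC.T" for m c t
    unfolding coact_mult_def Let_def by (rule MC.tensor_lift_pt[OF P.module outer[OF that(3)] that(1,2)])
  have sl: "(\<lambda>t. f t \<oplus>\<^bsub>P\<^esub> g t) \<in> linear_maps R MC.T P"
    if "f \<in> linear_maps R MC.T P" "g \<in> linear_maps R MC.T P" for f g
    using that by (auto simp: linear_maps_def Pi_iff P.T.smult_r_distr P.T.M.a_ac)
  have ml: "(\<lambda>t. a \<odot>\<^bsub>P\<^esub> f t) \<in> linear_maps R MC.T P"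
    if "f \<in> linear_maps R MC.T P" "a \<in> carrier R" for f a
    using that by (auto simp: linear_maps_def Pi_iff P.T.smult_r_distr P.T.smult_assoc1[symmetric] C.R.m_comm)
  note IL = linear_mapsD[OF inner_lift]
  have r: "coact_mult R C M N s \<in> linear_maps R NC.T P" if s: "s \<in> carrier MC.T" for s
    unfolding linear_maps_def
  proof (intro CollectI conjI ballI Pi_I)
    fix t t' a assume t: "t \<in> carrier NC.T" "t' \<in> carrier NC.T"
    show "coact_mult R C M N s (t \<oplus>\<^bsub>NC.T\<^esub> t') = coact_mult R C M N s t \<oplus>\<^bsub>P\<^esub> coact_mult R C M N s t'"
      by (rule MC.tensor_ext[OF P.module _ _ _ s, OF l sl[OF l l]]) (use t in \<open>auto simp: pt IL\<close>)
  next
    fix t a assume t: "t \<in> carrier NC.T" and a: "a \<in> carrier R"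
    show "coact_mult R C M N s (a \<odot>\<^bsub>NC.T\<^esub> t) = a \<odot>\<^bsub>P\<^esub> coact_mult R C M N s t"
      by (rule MC.tensor_ext[OF P.module _ _ _ s, OF l ml[OF l]]) (use t a in \<open>auto simp: pt IL\<close>)
  qed (use s ld in auto)
  show ?thesis using l r by (auto simp: bilinear_maps_def)
qed

lemma tensor_comod_simps:
  "carrier (tensor_comod R C M N) = carrier MN" "zero (tensor_comod R C M N) = zero MN"
  "add (tensor_comod R C M N) = add MN" "smult (tensor_comod R C M N) = smult MN"
  "coact (tensor_comod R C M N) = tensor_lift R P (\<lambda>m n. coact_mult R C M N (coact M m) (coact N n))"
  by (simp_all add: tensor_comod_def module.defs comod.defs)

lemma coact_bilinear: "(\<lambda>m n. coact_mult R C M N (coact M m) (coact N n)) \<in> bilinear_maps R M N P"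
proof -
  have b: "s \<in> carrier MC.T \<Longrightarrow> coact_mult R C M N s \<in> linear_maps R NC.T P"
    "t \<in> carrier NC.T \<Longrightarrow> (\<lambda>s. coact_mult R C M N s t) \<in> linear_maps R MC.T P" for s t
    using coact_mult_bilinear by (auto simp: bilinear_maps_def)
  note l = linear_maps_comp[OF coact_N b(1)] linear_maps_comp[OF coact_M b(2)]
  show ?thesis using linear_mapsD(1)[OF coact_M] linear_mapsD(1)[OF coact_N]
    by (auto simp: bilinear_maps_def intro!: l)
qed

lemma coact_linear: "coact (tensor_comod R C M N) \<in> linear_maps R MN P"
  unfolding tensor_comod_simps by (rule MN.tensor_lift_linear[OF P.module coact_bilinear])

lemma coact_pt: "m \<in> carrier M \<Longrightarrow> n \<in> carrier N \<Longrightarrow>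
    coact (tensor_comod R C M N) (MN.pt m n) = coact_mult R C M N (coact M m) (coact N n)"
  unfolding tensor_comod_simps by (rule MN.tensor_lift_pt[OF P.module coact_bilinear])

end

lemma quot_class_linear:
  assumes "module R M" "submodule U R M"
  shows "(\<lambda>m. U +>\<^bsub>M\<^esub> m) \<in> linear_maps R M (quot_module M U)"
proof -
  interpret module R M by fact
  interpret U: abelian_subgroup U M by (rule submodule_abelian_subgroup) fact+
  show ?thesis using quot_smult[OF assms] U.a_rcos_sum
    by (auto simp: linear_maps_def A_RCOSETS_def')
qed

lemma quot_comod_simps:
  "carrier (quot_comod R C M U) = carrier (quot_module M U)" "zero (quot_comod R C M U) = zero (quot_module M U)"
  "add (quot_comod R C M U) = add (quot_module M U)" "smult (quot_comod R C M U) = smult (quot_module M U)"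
  "coact (quot_comod R C M U) = (\<lambda>X. tensor_map R (quot_module M U) C (\<lambda>m. U +>\<^bsub>M\<^esub> m) id
        (coact M (SOME m. m \<in> X)))"
  by (simp_all add: quot_comod_def module.defs comod.defs)

lemma quot_comod_coact:
  assumes "module R M" "module R C" "submodule U R M" "coact M \<in> linear_maps R M (tensor_module R M C)"
    and stable: "\<And>u. u \<in> U \<Longrightarrow> tensor_map R (quot_module M U) C (\<lambda>m. U +>\<^bsub>M\<^esub> m) id (coact M u)
      = \<zero>\<^bsub>tensor_module R (quot_module M U) C\<^esub>"
    and m: "m \<in> carrier M"
  shows "coact (quot_comod R C M U) (U +>\<^bsub>M\<^esub> m) =
    tensor_map R (quot_module M U) C (\<lambda>m. U +>\<^bsub>M\<^esub> m) id (coact M m)"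
proof -
  interpret M: module R M by fact
  interpret U: abelian_subgroup U M by (rule submodule_abelian_subgroup) fact+
  interpret Q: module R "quot_module M U" by (rule quot_module_module) fact+
  interpret T: two_modules R "quot_module M U" C by (intro two_modules.intro Q.module_axioms assms)
  let ?q = "tensor_map R (quot_module M U) C (\<lambda>m. U +>\<^bsub>M\<^esub> m) id"
  have q: "?q \<in> linear_maps R (tensor_module R M C) T.T"
    by (rule tensor_map[OF assms(1,2) Q.module_axioms assms(2) quot_class_linear[OF assms(1,3)] linear_maps_id(2)])
  note L = linear_mapsD[OF linear_maps_comp[OF assms(4) q]]
  have "(SOME x. x \<in> U +>\<^bsub>M\<^esub> m) \<in> U +>\<^bsub>M\<^esub> m"
    using U.a_rcos_self[OF m] by (rule someI[where P = "\<lambda>x. x \<in> U +>\<^bsub>M\<^esub> m"])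
  then obtain u where u: "u \<in> U" "(SOME x. x \<in> U +>\<^bsub>M\<^esub> m) = u \<oplus>\<^bsub>M\<^esub> m"
    unfolding a_r_coset_def' by blast
  then have uM: "u \<in> carrier M" using U.a_Hcarr by simp
  show ?thesis unfolding quot_comod_simps u(2) L(2)[OF uM m] stable[OF u(1)]
    by (rule T.T.M.l_zero) (rule L(1)[OF m])
qed

locale comm_ring_base = cring A for A :: "('a, 'r) ring_scheme" (structure)
begin

abbreviation "V \<equiv> std_comod A"
abbreviation "e \<equiv> unit_vec A :: nat \<Rightarrow> nat \<Rightarrow> 'a"

lemma A: "cring A" by (rule is_cring)

sublocale kG: algebra A "kG A" by (rule kG_algebra[OF A])
sublocale V: module A V by (rule std_module[OF A])

sublocale VV: coact_tensor A "kG A" V V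
  by (intro coact_tensor.intro coact_tensor_axioms.intro kG.algebra_axioms V.module_axioms std_coact(1)[OF A])

lemma VV_simps:
  "carrier (VV_comod A) = carrier VV.MN" "zero (VV_comod A) = zero VV.MN"
  "add (VV_comod A) = add VV.MN" "smult (VV_comod A) = smult VV.MN"
  "coact (VV_comod A) = coact (tensor_comod A (kG A) V V)"
  unfolding VV_comod_def VV.tensor_comod_simps by (rule refl)+

lemma VV_module: "module A (VV_comod A)"
  by (rule module_transfer[OF VV.MN.module]) (simp_all add: VV_simps)

sublocale W: module A "VV_comod A" by (rule VV_module)

lemma tensor_VV: "tensor_module A (VV_comod A) C = tensor_module A VV.MN C"
    "pure_tensor A (VV_comod A) C = pure_tensor A VV.MN C"
  by (rule tensor_module_cong; simp add: VV_simps)+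

lemma lin_VV: "linear_maps A (VV_comod A) N = linear_maps A VV.MN N" "linear_maps A N (VV_comod A) = linear_maps A N VV.MN"
  by (simp_all add: linear_maps_def VV_simps)

lemma VV_coact: "coact (VV_comod A) \<in> linear_maps A (VV_comod A) (tensor_module A (VV_comod A) (kG A))"
  unfolding lin_VV tensor_VV VV_simps by (rule VV.coact_linear)

abbreviation "sym_rels \<equiv> {VV.MN.pt v w \<ominus>\<^bsub>VV_comod A\<^esub> VV.MN.pt w v | v w. v \<in> carrier V \<and> w \<in> carrier V}"
abbreviation "U \<equiv> span_module A (VV_comod A) sym_rels"

lemma Sym2_eq: "Sym2_comod A = quot_comod A (kG A) (VV_comod A) U"
  by (simp add: Sym2_comod_def Let_def)

lemma sym_rels: "sym_rels \<subseteq> carrier (VV_comod A)"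
  using W.M.minus_closed VV.MN.pt_closed unfolding VV_simps by blast

lemma U: "submodule U A (VV_comod A)"
  by (rule span_submodule[OF VV_module sym_rels])

sublocale Q: module A "quot_module (VV_comod A) U"
  by (rule quot_module_module[OF VV_module U])

sublocale QC: two_modules A "quot_module (VV_comod A) U" "kG A"
  by (intro two_modules.intro Q.module_axioms kG.module_axioms)

lemma class_swap:
  assumes "v \<in> carrier V" "w \<in> carrier V"
  shows "U +>\<^bsub>VV_comod A\<^esub> VV.MN.pt v w = U +>\<^bsub>VV_comod A\<^esub> VV.MN.pt w v"
proof -
  interpret U: abelian_subgroup U "VV_comod A" by (rule submodule_abelian_subgroup[OF VV_module U])
  have c: "VV.MN.pt v w \<in> carrier (VV_comod A)" "VV.MN.pt w v \<in> carrier (VV_comod A)"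
    unfolding VV_simps by (rule VV.MN.pt_closed assms)+
  have "VV.MN.pt v w \<ominus>\<^bsub>VV_comod A\<^esub> VV.MN.pt w v \<in> U"
    by (rule span_superset, rule CollectI, rule exI[of _ v], rule exI[of _ w]) (use assms in simp)
  then have "VV.MN.pt v w \<in> U +>\<^bsub>VV_comod A\<^esub> VV.MN.pt w v"
    unfolding a_minus_def[of "VV_comod A" "VV.MN.pt v w" "VV.MN.pt w v"]
    by (rule U.a_rcos_module_rev[OF c(2,1)])
  from U.a_repr_independence'[OF this c(2)] show ?thesis by (rule sym)
qed

abbreviation "q \<equiv> tensor_map A (quot_module (VV_comod A) U) (kG A) (\<lambda>m. U +>\<^bsub>VV_comod A\<^esub> m) id"

lemma q: "q \<in> linear_maps A VV.P QC.T"
    "t \<in> carrier VV.MN \<Longrightarrow> c \<in> carrier (kG A) \<Longrightarrow> q (VV.P.pt t c) = QC.pt (U +>\<^bsub>VV_comod A\<^esub> t) c"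
  using tensor_map[OF VV_module kG.module_axioms Q.module_axioms kG.module_axioms
      quot_class_linear[OF VV_module U] linear_maps_id(2)]
  unfolding tensor_VV by (auto simp: VV_simps)

lemma coact_mult_sym:
  assumes s: "s \<in> carrier VV.MC.T" and t: "t \<in> carrier VV.MC.T"
  shows "q (coact_mult A (kG A) V V s t) = q (coact_mult A (kG A) V V t s)"
proof -
  have b: "s \<in> carrier VV.MC.T \<Longrightarrow> coact_mult A (kG A) V V s \<in> linear_maps A VV.MC.T VV.P"
    "t \<in> carrier VV.MC.T \<Longrightarrow> (\<lambda>s. coact_mult A (kG A) V V s t) \<in> linear_maps A VV.MC.T VV.P" for s t
    using VV.coact_mult_bilinear by (auto simp: bilinear_maps_def)
  note l = linear_maps_comp[OF b(1) q(1)] linear_maps_comp[OF b(2) q(1)]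
  show ?thesis
  proof (rule VV.MC.tensor_ext[OF QC.module l(2)[OF t] l(1)[OF t] _ s])
    fix m c assume m: "m \<in> carrier V" "c \<in> carrier (kG A)"
    note mc = VV.MC.pt_closed[OF m]
    show "q (coact_mult A (kG A) V V (VV.MC.pt m c) t) = q (coact_mult A (kG A) V V t (VV.MC.pt m c))"
    proof (rule VV.MC.tensor_ext[OF QC.module l(1)[OF mc] l(2)[OF mc] _ t])
      fix n d assume n: "n \<in> carrier V" "d \<in> carrier (kG A)"
      show "q (coact_mult A (kG A) V V (VV.MC.pt m c) (VV.MC.pt n d))
          = q (coact_mult A (kG A) V V (VV.MC.pt n d) (VV.MC.pt m c))"
        using m n by (simp add: VV.coact_mult_pt q(2) VV.C_ring(1) VV.MN.pt_closed class_swap[OF m(1) n(1)])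
          (simp add: VV.C_ring(2)[OF m(2) n(2)])
    qed
  qed
qed

lemma U_stable: "u \<in> U \<Longrightarrow> q (coact (VV_comod A) u) = \<zero>\<^bsub>QC.T\<^esub>"
proof -
  have Z: "(\<lambda>_. \<zero>\<^bsub>QC.T\<^esub>) \<in> linear_maps A (VV_comod A) QC.T" by (auto simp: linear_maps_def)
  have L: "(\<lambda>u. q (coact (VV_comod A) u)) \<in> linear_maps A (VV_comod A) QC.T"
    using linear_maps_comp[OF VV_coact q(1)[folded tensor_VV]] .
  have "sym_rels \<subseteq> {u \<in> carrier (VV_comod A). q (coact (VV_comod A) u) = \<zero>\<^bsub>QC.T\<^esub>}"
  proof (clarify, intro conjI)
    fix v w assume v: "v \<in> carrier V" and w: "w \<in> carrier V"
    then have p: "VV.MN.pt v w \<in> carrier (VV_comod A)" "VV.MN.pt w v \<in> carrier (VV_comod A)"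
      by (simp_all add: VV_simps VV.MN.pt_closed)
    show "VV.MN.pt v w \<ominus>\<^bsub>VV_comod A\<^esub> VV.MN.pt w v \<in> carrier (VV_comod A)" using p by (rule W.M.minus_closed)
    have "q (coact (VV_comod A) (VV.MN.pt v w)) = q (coact (VV_comod A) (VV.MN.pt w v))"
      unfolding VV_simps using v w linear_mapsD(1)[OF VV.coact_M] by (simp add: VV.coact_pt coact_mult_sym)
    then show "q (coact (VV_comod A) (VV.MN.pt v w \<ominus>\<^bsub>VV_comod A\<^esub> VV.MN.pt w v)) = \<zero>\<^bsub>QC.T\<^esub>"
      using linear_maps_uminus(3)[OF VV_module QC.module L p] QC.T.M.r_neg[OF linear_mapsD(1)[OF L p(2)]]
      unfolding a_minus_def[of QC.T] by (simp only:)
  qed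
  then have "U \<subseteq> {u \<in> carrier (VV_comod A). q (coact (VV_comod A) u) = \<zero>\<^bsub>QC.T\<^esub>}"
    by (rule span_least[OF eq_submodule[OF VV_module QC.module L Z]])
  then show "u \<in> U \<Longrightarrow> q (coact (VV_comod A) u) = \<zero>\<^bsub>QC.T\<^esub>" by blast
qed

lemma Sym2_coact:
  assumes "v \<in> carrier V" "w \<in> carrier V"
  shows "coact (Sym2_comod A) (U +>\<^bsub>VV_comod A\<^esub> VV.MN.pt v w) =
    q (coact_mult A (kG A) V V (coact V v) (coact V w))"
  unfolding Sym2_eq
  by (subst quot_comod_coact[OF VV_module kG.module_axioms U VV_coact U_stable])
    (use assms in \<open>simp_all add: VV_simps VV.MN.pt_closed VV.coact_pt\<close>)

end

lemma linear_sum_smult: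
  assumes "module R N" "f \<in> linear_maps R M N" "g \<in> linear_maps R M N"
  shows "(\<lambda>t. f t \<oplus>\<^bsub>N\<^esub> g t) \<in> linear_maps R M N"
proof -
  interpret N: module R N by fact
  show ?thesis using assms(2,3) by (auto simp: linear_maps_def Pi_iff N.smult_r_distr N.M.a_ac)
qed

context comm_ring_base
begin

definition "SA = ring.extend (ring.truncate A) (module.fields (\<lambda>a p. id a \<otimes> p))"

sublocale SA: algebra A SA unfolding SA_def by (rule hom_algebra[OF A A]) (auto intro: ring_hom_memI)

lemma SA_simps: "carrier SA = carrier A" "add SA = add A" "smult SA = monoid.mult A" "zero SA = zero A"
  by (simp_all add: SA_def ring.defs module.defs)

lemma V_simps: "carrier V = carrier (free_module A {1, 2::nat})" "add V = add (free_module A {1, 2::nat})"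
   "smult V = smult (free_module A {1, 2::nat})"
  by (simp_all add: std_simps std_module_def)

lemma e_carrier: "i \<in> {1, 2} \<Longrightarrow> e i \<in> carrier V"
  unfolding V_simps by (rule unit_vec_carrier[OF A])

lemma V_coord: "v \<in> carrier V \<Longrightarrow> v i \<in> carrier A"
  unfolding V_simps by (cases "i \<in> {1, 2}") auto

lemma V_expand: "v \<in> carrier V \<Longrightarrow> v = (v 1 \<odot>\<^bsub>V\<^esub> e 1) \<oplus>\<^bsub>V\<^esub> (v 2 \<odot>\<^bsub>V\<^esub> e 2)"
proof
  fix i assume v: "v \<in> carrier V"
  then have "v i \<in> carrier A" for i by (rule V_coord)
  moreover have "i \<noteq> 1 \<Longrightarrow> i \<noteq> 2 \<Longrightarrow> v i = \<zero>" using v unfolding V_simps by auto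
  ultimately show "v i = ((v 1 \<odot>\<^bsub>V\<^esub> e 1) \<oplus>\<^bsub>V\<^esub> (v 2 \<odot>\<^bsub>V\<^esub> e 2)) i"
    by (auto simp: V_simps unit_vec_def)
qed

abbreviation "cc i j \<equiv> tensor_lift A SA (\<lambda>v w. v i \<otimes> w j)"
abbreviation "ee i j \<equiv> VV.MN.pt (e i) (e j)"

lemma cc: "cc i j \<in> linear_maps A VV.MN SA"
  "v \<in> carrier V \<Longrightarrow> w \<in> carrier V \<Longrightarrow> cc i j (VV.MN.pt v w) = v i \<otimes> w j"
proof -
  have b: "(\<lambda>v w. v i \<otimes> w j) \<in> bilinear_maps A V V SA"
    unfolding bilinear_maps_def linear_maps_def SA_simps V_simps(2,3)
    by (auto simp: V_coord l_distr r_distr m_assoc m_lcomm)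
  show "cc i j \<in> linear_maps A VV.MN SA" by (rule VV.MN.tensor_lift_linear[OF SA.module b])
  show "v \<in> carrier V \<Longrightarrow> w \<in> carrier V \<Longrightarrow> cc i j (VV.MN.pt v w) = v i \<otimes> w j"
    by (rule VV.MN.tensor_lift_pt[OF SA.module b])
qed

lemma cc_closed: "t \<in> carrier VV.MN \<Longrightarrow> cc i j t \<in> carrier A"
  using linear_mapsD(1)[OF cc(1)] by (simp add: SA_simps)

lemma cc_smult: "x \<in> carrier VV.MN \<Longrightarrow> (\<lambda>t. cc i j t \<odot>\<^bsub>VV.MN\<^esub> x) \<in> linear_maps A VV.MN VV.MN"
  using linear_mapsD[OF cc(1)[of i j]]
  by (auto simp: linear_maps_def SA_simps VV.MN.T.smult_l_distr VV.MN.T.smult_assoc1)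

lemma ee_closed: "i \<in> {1, 2} \<Longrightarrow> j \<in> {1, 2} \<Longrightarrow> ee i j \<in> carrier VV.MN"
  by (intro VV.MN.pt_closed e_carrier)

lemmas ee_closed' [simp] = ee_closed[of 1 1, simplified] ee_closed[of 1 2, simplified]
  ee_closed[of 2 1, simplified] ee_closed[of 2 2, simplified]

lemmas e_carrier' [simp] = e_carrier[of 1, simplified] e_carrier[of 2, simplified]

lemma VV_expand:
  assumes "t \<in> carrier VV.MN"
  shows "t = (cc 1 1 t \<odot>\<^bsub>VV.MN\<^esub> ee 1 1 \<oplus>\<^bsub>VV.MN\<^esub> cc 1 2 t \<odot>\<^bsub>VV.MN\<^esub> ee 1 2)
    \<oplus>\<^bsub>VV.MN\<^esub> (cc 2 1 t \<odot>\<^bsub>VV.MN\<^esub> ee 2 1 \<oplus>\<^bsub>VV.MN\<^esub> cc 2 2 t \<odot>\<^bsub>VV.MN\<^esub> ee 2 2)"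
proof (rule VV.MN.tensor_ext[OF VV.MN.module linear_maps_id(1) _ _ assms])
  show "(\<lambda>t. (cc 1 1 t \<odot>\<^bsub>VV.MN\<^esub> ee 1 1 \<oplus>\<^bsub>VV.MN\<^esub> cc 1 2 t \<odot>\<^bsub>VV.MN\<^esub> ee 1 2)
    \<oplus>\<^bsub>VV.MN\<^esub> (cc 2 1 t \<odot>\<^bsub>VV.MN\<^esub> ee 2 1 \<oplus>\<^bsub>VV.MN\<^esub> cc 2 2 t \<odot>\<^bsub>VV.MN\<^esub> ee 2 2)) \<in> linear_maps A VV.MN VV.MN"
    by (intro linear_sum_smult VV.MN.module cc_smult) simp_all
  fix v w assume v: "v \<in> carrier V" and w: "w \<in> carrier V"
  have c: "v i \<in> carrier A" "w i \<in> carrier A" for i using v w V_coord by auto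
  have s: "v i \<odot>\<^bsub>V\<^esub> e j \<in> carrier V" "w i \<odot>\<^bsub>V\<^esub> e j \<in> carrier V" if "j \<in> {1,2}" for i j
    using c e_carrier[OF that] by auto
  have "VV.MN.pt v w = VV.MN.pt ((v 1 \<odot>\<^bsub>V\<^esub> e 1) \<oplus>\<^bsub>V\<^esub> (v 2 \<odot>\<^bsub>V\<^esub> e 2)) ((w 1 \<odot>\<^bsub>V\<^esub> e 1) \<oplus>\<^bsub>V\<^esub> (w 2 \<odot>\<^bsub>V\<^esub> e 2))"
    using V_expand[OF v] V_expand[OF w] by simp
  also have "\<dots> = ((v 1 \<otimes> w 1) \<odot>\<^bsub>VV.MN\<^esub> ee 1 1 \<oplus>\<^bsub>VV.MN\<^esub> (v 1 \<otimes> w 2) \<odot>\<^bsub>VV.MN\<^esub> ee 1 2)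
    \<oplus>\<^bsub>VV.MN\<^esub> ((v 2 \<otimes> w 1) \<odot>\<^bsub>VV.MN\<^esub> ee 2 1 \<oplus>\<^bsub>VV.MN\<^esub> (v 2 \<otimes> w 2) \<odot>\<^bsub>VV.MN\<^esub> ee 2 2)"
    using c s by (simp add: VV.pts VV.MN.T.smult_r_distr VV.MN.T.smult_assoc1[symmetric] m_comm VV.MN.T.M.a_ac)
  finally show "VV.MN.pt v w = (cc 1 1 (VV.MN.pt v w) \<odot>\<^bsub>VV.MN\<^esub> ee 1 1 \<oplus>\<^bsub>VV.MN\<^esub> cc 1 2 (VV.MN.pt v w) \<odot>\<^bsub>VV.MN\<^esub> ee 1 2)
    \<oplus>\<^bsub>VV.MN\<^esub> (cc 2 1 (VV.MN.pt v w) \<odot>\<^bsub>VV.MN\<^esub> ee 2 1 \<oplus>\<^bsub>VV.MN\<^esub> cc 2 2 (VV.MN.pt v w) \<odot>\<^bsub>VV.MN\<^esub> ee 2 2)"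
    unfolding cc(2)[OF v w] .
qed

lemma swap: "tensor_swap A \<in> linear_maps A VV.MN VV.MN"
  "v \<in> carrier V \<Longrightarrow> w \<in> carrier V \<Longrightarrow> tensor_swap A (VV.MN.pt v w) = VV.MN.pt w v"
proof -
  have b: "(\<lambda>v w. VV.MN.pt w v) \<in> bilinear_maps A V V (VV_comod A)"
    unfolding bilinear_maps_def lin_VV by (auto simp: linear_maps_def VV.pts)
  show "tensor_swap A \<in> linear_maps A VV.MN VV.MN"
    using VV.MN.tensor_lift_linear[OF VV_module b] unfolding tensor_swap_def lin_VV .
  show "v \<in> carrier V \<Longrightarrow> w \<in> carrier V \<Longrightarrow> tensor_swap A (VV.MN.pt v w) = VV.MN.pt w v"
    unfolding tensor_swap_def by (rule VV.MN.tensor_lift_pt[OF VV_module b])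
qed

lemma cc_swap: "t \<in> carrier VV.MN \<Longrightarrow> cc i j (tensor_swap A t) = cc j i t"
  by (rule VV.MN.tensor_ext[OF SA.module linear_maps_comp[OF swap(1) cc(1)] cc(1)])
    (auto simp: swap(2) cc(2) V_coord m_comm)

abbreviation "symt \<equiv> {t \<in> carrier (VV_comod A). tensor_swap A t = t}"
abbreviation "ss \<equiv> ee 1 2 \<oplus>\<^bsub>VV.MN\<^esub> ee 2 1"
abbreviation "S \<equiv> VV_comod A\<lparr>carrier := symt\<rparr>"

definition "retr t = cc 1 1 t \<odot>\<^bsub>VV.MN\<^esub> ee 1 1 \<oplus>\<^bsub>VV.MN\<^esub>
    (cc 1 2 t \<odot>\<^bsub>VV.MN\<^esub> ss \<oplus>\<^bsub>VV.MN\<^esub> cc 2 2 t \<odot>\<^bsub>VV.MN\<^esub> ee 2 2)"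

lemma retr: "retr \<in> linear_maps A VV.MN VV.MN"
  unfolding retr_def[abs_def] by (intro linear_sum_smult VV.MN.module cc_smult) simp_all

lemma sym_simps: "t \<in> symt \<longleftrightarrow> t \<in> carrier VV.MN \<and> tensor_swap A t = t"
  by (simp add: VV_simps)

lemma sym_submodule: "submodule symt A (VV_comod A)"
  using eq_submodule[OF VV_module VV_module, of "tensor_swap A" "\<lambda>x. x"] swap(1)
  by (simp add: lin_VV linear_maps_id)

sublocale S: module A S by (rule submodule.submodule_is_module[OF sym_submodule VV_module])

lemma retr_sym: "t \<in> carrier VV.MN \<Longrightarrow> retr t \<in> symt"
  unfolding sym_simps retr_def
  by (simp add: cc_closed linear_mapsD[OF swap(1)] swap(2) VV.MN.T.M.a_comm)

lemma retr_id: assumes "t \<in> symt" shows "retr t = t"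
proof -
  have t: "t \<in> carrier VV.MN" and s: "tensor_swap A t = t" using assms by (auto simp: VV_simps)
  have "cc 2 1 t = cc 1 2 t" using cc_swap[OF t, of 1 2] s by simp
  then show ?thesis using VV_expand[OF t] t
    by (simp add: retr_def cc_closed VV.MN.T.smult_r_distr VV.MN.T.M.a_ac)
qed

lemma lin_S: "retr \<in> linear_maps A (VV_comod A) S" "id \<in> linear_maps A S (VV_comod A)"
  using retr retr_sym by (auto simp: linear_maps_def VV_simps)

sublocale SC: two_modules A S "kG A" by (intro two_modules.intro S.module_axioms kG.module_axioms)

lemma sC: "tensor_map A S (kG A) retr id \<in> linear_maps A VV.P SC.T"
   "t \<in> carrier VV.MN \<Longrightarrow> c \<in> carrier (kG A) \<Longrightarrow> tensor_map A S (kG A) retr id (VV.P.pt t c) = SC.pt (retr t) c"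
  using tensor_map[OF VV_module kG.module_axioms S.module_axioms kG.module_axioms lin_S(1) linear_maps_id(2)]
  unfolding tensor_VV by (auto simp: VV_simps)

lemma iC: "tensor_map A (VV_comod A) (kG A) id id \<in> linear_maps A SC.T VV.P"
   "t \<in> symt \<Longrightarrow> c \<in> carrier (kG A) \<Longrightarrow> tensor_map A (VV_comod A) (kG A) id id (SC.pt t c) = VV.P.pt t c"
  using tensor_map[OF S.module_axioms kG.module_axioms VV_module kG.module_axioms lin_S(2) linear_maps_id(2)]
  unfolding tensor_VV by (auto simp: VV_simps)

abbreviation "\<iota> \<equiv> tensor_map A (VV_comod A) (kG A) id id"
abbreviation "\<rho> \<equiv> tensor_map A S (kG A) retr id"

lemma S_carrier: "carrier S = symt" by simp

lemma symD: "t \<in> symt \<Longrightarrow> t \<in> carrier VV.MN"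
  by (simp add: VV_simps)

lemma \<rho>\<iota>: assumes "t \<in> carrier SC.T" shows "\<rho> (\<iota> t) = t"
proof (rule SC.tensor_ext[OF SC.module linear_maps_comp[OF iC(1) sC(1)] linear_maps_id(1) _ assms], unfold S_carrier)
  fix m n assume m: "m \<in> symt" and n: "n \<in> carrier (kG A)"
  show "\<rho> (\<iota> (SC.pt m n)) = SC.pt m n"
    unfolding iC(2)[OF m n] sC(2)[OF symD[OF m] n] retr_id[OF m] ..
qed

abbreviation "gx i j \<equiv> kG_x A i j"
abbreviation "pe i j a b c d \<equiv> VV.P.pt (ee i j) (gx a b \<otimes>\<^bsub>kG A\<^esub> gx c d)"

lemma xx: "gx a b \<otimes>\<^bsub>kG A\<^esub> gx c d \<in> carrier (kG A)" by (intro VV.C_ring kG_x_carrier A)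

lemma coact_ee:
  assumes "a \<in> {1, 2}" "b \<in> {1, 2}"
  shows "coact (VV_comod A) (ee a b) =
    (pe 1 1 1 a 1 b \<oplus>\<^bsub>VV.P\<^esub> pe 1 2 1 a 2 b) \<oplus>\<^bsub>VV.P\<^esub> (pe 2 1 2 a 1 b \<oplus>\<^bsub>VV.P\<^esub> pe 2 2 2 a 2 b)"
proof -
  have b: "s \<in> carrier VV.MC.T \<Longrightarrow> coact_mult A (kG A) V V s \<in> linear_maps A VV.MC.T VV.P"
    "t \<in> carrier VV.MC.T \<Longrightarrow> (\<lambda>s. coact_mult A (kG A) V V s t) \<in> linear_maps A VV.MC.T VV.P" for s t
    using VV.coact_mult_bilinear by (auto simp: bilinear_maps_def)
  have p: "VV.MC.pt (e i) (gx k l) \<in> carrier VV.MC.T" if "i \<in> {1, 2}" for i k l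
    by (intro VV.MC.pt_closed e_carrier kG_x_carrier A that)
  note p' = p[of 1, simplified] p[of 2, simplified]
  show ?thesis
    unfolding VV_simps VV.coact_pt[OF e_carrier[OF assms(1)] e_carrier[OF assms(2)]]
      std_coact(2)[OF A assms(1)] std_coact(2)[OF A assms(2)]
    by (simp add: linear_mapsD(2)[OF b(1)] linear_mapsD(2)[OF b(2)] p' VV.coact_mult_pt kG_x_carrier[OF A])
      (simp add: VV.P.T.M.a_ac VV.P.pt_closed xx)
qed

lemma sub_stable: assumes "t \<in> symt" shows "\<iota> (\<rho> (coact (VV_comod A) t)) = coact (VV_comod A) t"
proof -
  let ?D = "coact (VV_comod A)"
  let ?g = "\<lambda>t. \<iota> (\<rho> t)"
  have D: "?D \<in> linear_maps A VV.MN VV.P" using VV_coact unfolding lin_VV tensor_VV .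
  have g: "?g \<in> linear_maps A VV.P VV.P" by (rule linear_maps_comp[OF sC(1) iC(1)])
  note gD = linear_maps_comp[OF D g]
  have gp: "?g (VV.P.pt t c) = VV.P.pt (retr t) c" if "t \<in> carrier VV.MN" "c \<in> carrier (kG A)" for t c
    using that retr_sym[OF that(1)] by (simp add: sC iC)
  have ev: "e i j = (if j = i then \<one> else \<zero>)" for i j by (simp add: unit_vec_def)
  have r: "retr (ee 1 1) = ee 1 1" "retr (ee 1 2) = ss" "retr (ee 2 1) = \<zero>\<^bsub>VV.MN\<^esub>" "retr (ee 2 2) = ee 2 2"
    by (simp_all add: retr_def cc(2) ev)
  have z: "VV.P.pt \<zero>\<^bsub>VV.MN\<^esub> c = \<zero>\<^bsub>VV.P\<^esub>" if "c \<in> carrier (kG A)" for c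
    using VV.P.pt_smult_l[OF zero_closed VV.MN.T.M.zero_closed that] VV.P.pt_closed[OF VV.MN.T.M.zero_closed that] by simp
  have pc: "VV.P.pt (ee i j) c \<in> carrier VV.P" if "i \<in> {1, 2}" "j \<in> {1, 2}" "c \<in> carrier (kG A)" for i j c
    by (intro VV.P.pt_closed ee_closed that)
  note pc' = pc[of 1 1, simplified] pc[of 1 2, simplified] pc[of 2 1, simplified] pc[of 2 2, simplified]
  note G = linear_mapsD[OF g]
  have c: "gx a b \<otimes>\<^bsub>kG A\<^esub> gx c d = gx c d \<otimes>\<^bsub>kG A\<^esub> gx a b" for a b c d
    by (rule VV.C_ring(2)) (rule kG_x_carrier[OF A])+
  note ce = coact_ee[of 1 1, simplified] coact_ee[of 1 2, simplified] coact_ee[of 2 1, simplified] coact_ee[of 2 2, simplified]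
  have gee: "?g (?D (ee a b)) = (pe 1 1 1 a 1 b \<oplus>\<^bsub>VV.P\<^esub> (pe 1 2 1 a 2 b \<oplus>\<^bsub>VV.P\<^esub> pe 2 1 1 a 2 b)) \<oplus>\<^bsub>VV.P\<^esub> pe 2 2 2 a 2 b"
    if "a \<in> {1,2}" "b \<in> {1, 2}" for a b
    unfolding coact_ee[OF that] by (simp add: G(1,2) xx gp r[unfolded One_nat_def] z pc' VV.P.pt_add_l)
  have 1: "?g (?D (ee 1 1)) = ?D (ee 1 1)" "?g (?D (ee 2 2)) = ?D (ee 2 2)"
    using gee[of 1 1] gee[of 2 2] ce
    by (simp_all add: xx pc' VV.P.T.M.a_ac c[of 2 1 1 1, unfolded One_nat_def] c[of 2 2 1 2, unfolded One_nat_def])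
  have gs: "?g (?D ss) = ?g (?D (ee 1 2)) \<oplus>\<^bsub>VV.P\<^esub> ?g (?D (ee 2 1))"
    by (rule linear_mapsD(2)[OF gD]) simp_all
  have Ds: "?D ss = ?D (ee 1 2) \<oplus>\<^bsub>VV.P\<^esub> ?D (ee 2 1)"
    by (rule linear_mapsD(2)[OF D]) simp_all
  have i: "1 \<in> {1, 2::nat}" "2 \<in> {1, 2::nat}" by simp_all
  have 2: "?g (?D ss) = ?D ss"
    unfolding gs gee[OF i] gee[OF i(2,1)] unfolding Ds coact_ee[OF i] coact_ee[OF i(2,1)]
    by (simp add: xx pc' VV.P.T.M.a_ac c[of 2 1 1 2, unfolded One_nat_def] c[of 2 2 1 1, unfolded One_nat_def])
  have "?g (?D (retr t)) = ?D (retr t)" if t: "t \<in> carrier VV.MN" for t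
  proof -
    have L: "f (retr t) = cc 1 1 t \<odot>\<^bsub>VV.P\<^esub> f (ee 1 1) \<oplus>\<^bsub>VV.P\<^esub>
        (cc 1 2 t \<odot>\<^bsub>VV.P\<^esub> f ss \<oplus>\<^bsub>VV.P\<^esub> cc 2 2 t \<odot>\<^bsub>VV.P\<^esub> f (ee 2 2))" if f: "f \<in> linear_maps A VV.MN VV.P" for f
    proof -
      have cl: "cc i j t \<odot>\<^bsub>VV.MN\<^esub> y \<in> carrier VV.MN" if "y \<in> carrier VV.MN" for i j y
        using that cc_closed[OF t] by simp
      have s: "ss \<in> carrier VV.MN" by simp
      note cl' = cl[OF ee_closed(1)[of 1 1, OF i(1) i(1)]] cl[OF s] cl[OF ee_closed(1)[of 2 2, OF i(2) i(2)]]
      show ?thesis unfolding retr_def linear_mapsD(2)[OF f cl'(1) VV.MN.T.M.a_closed[OF cl'(2,3)]]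
          linear_mapsD(2)[OF f cl'(2,3)] linear_mapsD(3)[OF f cc_closed[OF t] s]
          linear_mapsD(3)[OF f cc_closed[OF t] ee_closed[OF i(1) i(1)]]
          linear_mapsD(3)[OF f cc_closed[OF t] ee_closed[OF i(2) i(2)]] ..
    qed
    show ?thesis using L[OF D] L[OF gD] unfolding 1 2 by (rule trans[OF _ sym, rotated])
  qed
  from this[of t] show ?thesis using retr_id[OF assms] assms by (simp add: VV_simps)
qed

lemma sub_comod_carrier: "carrier (sub_comod R C M Z) = Z"
  by (simp add: sub_comod_def module.defs comod.defs)

lemma sub_comod_eq: "coact (sub_comod R C M Z) u = (THE t. t \<in> carrier (tensor_module R (M \<lparr>carrier := Z\<rparr>) C) \<and>
        tensor_map R M C id id t = coact M u)"
  by (simp add: sub_comod_def module.defs comod.defs)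

lemma S2_coact:
  assumes "t \<in> carrier (S2_comod A)"
  shows "coact (S2_comod A) t \<in> carrier SC.T" "\<iota> (coact (S2_comod A) t) = coact (VV_comod A) t"
    and "\<exists>!s. s \<in> carrier SC.T \<and> \<iota> s = coact (VV_comod A) t"
proof -
  have t: "t \<in> symt" using assms by (simp only: S2_comod_def sub_comod_carrier)
  have D: "coact (VV_comod A) \<in> linear_maps A VV.MN VV.P" using VV_coact unfolding lin_VV tensor_VV .
  have "coact (VV_comod A) t \<in> carrier VV.P" by (rule linear_mapsD(1)[OF D symD[OF t]])
  then have c: "\<rho> (coact (VV_comod A) t) \<in> carrier SC.T" by (rule linear_mapsD(1)[OF sC(1)])
  show *: "\<exists>!s. s \<in> carrier SC.T \<and> \<iota> s = coact (VV_comod A) t"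
  proof (rule ex1I, rule conjI, rule c, rule sub_stable[OF t])
    fix s assume "s \<in> carrier SC.T \<and> \<iota> s = coact (VV_comod A) t"
    then show "s = \<rho> (coact (VV_comod A) t)" using \<rho>\<iota>[of s] by (elim conjE) (simp only:)
  qed
  have "coact (S2_comod A) t = (THE s. s \<in> carrier SC.T \<and> \<iota> s = coact (VV_comod A) t)"
    unfolding S2_comod_def sub_comod_eq ..
  then show "coact (S2_comod A) t \<in> carrier SC.T" "\<iota> (coact (S2_comod A) t) = coact (VV_comod A) t"
    using theI'[OF *] by (simp_all only:)
qed

end

end

theory Submission
  imports Defs
begin

text \<open>
  On basis vectors, \<open>e\<^sub>i\<^sup>2 \<mapsto> e\<^sub>i \<otimes> e\<^sub>i\<close> and \<open>e\<^sub>1e\<^sub>2 \<mapsto> e\<^sub>1 \<otimes> e\<^sub>2 + e\<^sub>2 \<otimes> e\<^sub>1\<close> define a linear isomorphism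
  from the symmetric square to the symmetric tensors. The two coactions differ only by factors 2 in front of
  \<open>x\<^sub>1\<^sub>1x\<^sub>2\<^sub>1\<close>, \<open>x\<^sub>1\<^sub>2x\<^sub>2\<^sub>2\<close>, \<open>x\<^sub>1\<^sub>1x\<^sub>1\<^sub>2\<close> and \<open>x\<^sub>2\<^sub>1x\<^sub>2\<^sub>2\<close>, all of which lie in \<open>I\<^sub>1I\<^sub>2\<close>.

  Over the integers, let \<open>\<phi>\<close> be an isomorphism of comodules over \<open>k[G]\<close>, and compare the coefficients
  of \<open>e\<^sub>1 \<otimes> e\<^sub>2\<close> in \<open>\<Delta>(\<phi>(e\<^sub>1\<^sup>2))\<close> and \<open>(\<phi> \<otimes> id)(\<Delta>(e\<^sub>1\<^sup>2))\<close>. Evaluated at five integer matrices of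
  determinant 1 or -1, they show that \<open>\<phi>(e\<^sub>1\<^sup>2)\<close> is an even multiple of \<open>e\<^sub>1 \<otimes> e\<^sub>1\<close>,
  whereas \<open>e\<^sub>1\<^sup>2\<close> is not divisible by 2.
\<close>

subsection \<open>Maps out of quotients\<close>

text \<open>Phrased for any \<open>f\<close> whose values on cosets are prescribed, so that it
  covers \<open>quot_lift\<close> and also \<open>kN_to_kT\<close>, which is not computed on
  representatives.\<close>

lemma linear_maps_from_quot:
  assumes "module R M" "submodule U R M" "g \<in> linear_maps R M N"
    "\<And>m. m \<in> carrier M \<Longrightarrow> f (U +>\<^bsub>M\<^esub> m) = g m"
  shows "f \<in> linear_maps R (quot_module M U) N"
proof -
  interpret module R M by fact
  note c = linear_mapsD(2,3)[OF quot_class_linear[OF assms(1,2)], symmetric]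
  note g = linear_mapsD[OF assms(3)]
  show ?thesis unfolding linear_maps_def
    by (auto elim!: quot_carrierE simp del: quot_module_simps simp: c assms(4) g)
qed

definition quot_lift :: "('m \<Rightarrow> 'n) \<Rightarrow> 'm set \<Rightarrow> 'n"
  where "quot_lift f X = f (SOME x. x \<in> X)"

text \<open>The chosen representative of the coset of \<open>m\<close> differs from \<open>m\<close>
  by an element of \<open>U\<close>, which \<open>f\<close> kills.\<close>

lemma quot_lift:
  assumes "module R M" "submodule U R M" "module R N" "f \<in> linear_maps R M N"
    "U \<subseteq> {u \<in> carrier M. f u = \<zero>\<^bsub>N\<^esub>}"
  shows "quot_lift f \<in> linear_maps R (quot_module M U) N"
    and "m \<in> carrier M \<Longrightarrow> quot_lift f (U +>\<^bsub>M\<^esub> m) = f m"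
proof -
  interpret M: module R M by fact
  interpret N: module R N by fact
  interpret U: abelian_subgroup U M by (rule submodule_abelian_subgroup) fact+
  show *: "quot_lift f (U +>\<^bsub>M\<^esub> m) = f m" if m: "m \<in> carrier M" for m
  proof -
    have "(SOME x. x \<in> U +>\<^bsub>M\<^esub> m) \<in> U +>\<^bsub>M\<^esub> m"
      using U.a_rcos_self[OF m] by (rule someI[where P = "\<lambda>x. x \<in> U +>\<^bsub>M\<^esub> m"])
    then obtain u where u: "u \<in> U" "(SOME x. x \<in> U +>\<^bsub>M\<^esub> m) = u \<oplus>\<^bsub>M\<^esub> m"
      unfolding a_r_coset_def' by blast
    then have "u \<in> carrier M" "f u = \<zero>\<^bsub>N\<^esub>" using assms(5) by auto
    then show ?thesis unfolding quot_lift_def u(2) using linear_mapsD[OF assms(4)] m by simp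
  qed
  show "quot_lift f \<in> linear_maps R (quot_module M U) N"
    by (rule linear_maps_from_quot[OF assms(1,2,4) *])
qed

lemma quot_alg_simps:
  "carrier (quot_alg C I) = carrier (quot_module C I)" "add (quot_alg C I) = add (quot_module C I)"
  "zero (quot_alg C I) = zero (quot_module C I)" "smult (quot_alg C I) = smult (quot_module C I)"
  "monoid.mult (quot_alg C I) = rcoset_mult C I"
  by (simp_all add: quot_alg_def FactRing_def ring.defs module.defs)

lemma linear_maps_quot_alg:
  "linear_maps R (quot_alg C I) N = linear_maps R (quot_module C I) N"
  "linear_maps R N (quot_alg C I) = linear_maps R N (quot_module C I)"
  by (simp_all add: linear_maps_def quot_alg_simps del: quot_module_simps)

text \<open>A scalar acts as multiplication by its image in \<open>C\<close>, and an ideal absorbs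
  such multiplications.\<close>

lemma ideal_submodule:
  assumes "algebra R C" "ideal I C" shows "submodule I R C"
proof -
  interpret algebra R C by fact
  interpret I: ideal I C by fact
  show ?thesis
  proof (rule submoduleI)
    fix a x assume "a \<in> carrier R" "x \<in> I"
    then have "a \<odot>\<^bsub>C\<^esub> x = (a \<odot>\<^bsub>C\<^esub> \<one>\<^bsub>C\<^esub>) \<otimes>\<^bsub>C\<^esub> x" using smult_assoc2[of a "\<one>\<^bsub>C\<^esub>" x] by (simp add: I.a_Hcarr)
    then show "a \<odot>\<^bsub>C\<^esub> x \<in> I" using \<open>x \<in> I\<close> \<open>a \<in> carrier R\<close> by (simp add: I.I_l_closed)
  qed (auto simp: I.a_Hcarr)
qed

lemma quot_alg_class_linear:
  assumes "algebra R C" "ideal I C"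
  shows "(\<lambda>c. I +>\<^bsub>C\<^esub> c) \<in> linear_maps R C (quot_alg C I)"
  unfolding linear_maps_quot_alg
  by (rule quot_class_linear[OF _ ideal_submodule[OF assms]]) (use assms(1) in \<open>simp add: algebra_def\<close>)

text \<open>\<open>I\<close> absorbs \<open>J\<close>, and since \<open>J\<close> contains zero
  nothing of the coset of \<open>I\<close> is lost. For \<open>ideal_I1\<close> and the product
  ideal this shows that \<open>kN_to_kT\<close> is the natural projection on classes.\<close>

lemma set_add_coset:
  assumes "ideal I C" "J \<subseteq> I" "\<zero>\<^bsub>C\<^esub> \<in> J" "c \<in> carrier C"
  shows "I <+>\<^bsub>C\<^esub> (J +>\<^bsub>C\<^esub> c) = I +>\<^bsub>C\<^esub> c"
proof -
  interpret I: ideal I C by fact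
  show ?thesis
  proof (intro equalityI subsetI)
    fix x assume "x \<in> I <+>\<^bsub>C\<^esub> (J +>\<^bsub>C\<^esub> c)"
    then obtain i j where ij: "i \<in> I" "j \<in> J" "x = i \<oplus>\<^bsub>C\<^esub> (j \<oplus>\<^bsub>C\<^esub> c)"
      by (auto simp: set_add_def' a_r_coset_def')
    with assms(2,4) have "x = (i \<oplus>\<^bsub>C\<^esub> j) \<oplus>\<^bsub>C\<^esub> c" by (simp add: I.a_assoc I.a_Hcarr subsetD)
    moreover have "i \<oplus>\<^bsub>C\<^esub> j \<in> I" using ij assms(2) by (auto intro: I.a_closed)
    ultimately show "x \<in> I +>\<^bsub>C\<^esub> c" by (auto simp: a_r_coset_def')
  next
    fix x assume "x \<in> I +>\<^bsub>C\<^esub> c"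
    then obtain i where i: "i \<in> I" "x = i \<oplus>\<^bsub>C\<^esub> c" by (auto simp: a_r_coset_def')
    then have "x = i \<oplus>\<^bsub>C\<^esub> (\<zero>\<^bsub>C\<^esub> \<oplus>\<^bsub>C\<^esub> c)" using assms(4) by simp
    then show "x \<in> I <+>\<^bsub>C\<^esub> (J +>\<^bsub>C\<^esub> c)" using i(1) assms(3) unfolding set_add_def' a_r_coset_def' by blast
  qed
qed

section \<open>The maps from k[G] to k[N] and from k[N] to k[T]\<close>

lemma kG_to_kN_linear: "cring A \<Longrightarrow> kG_to_kN A \<in> linear_maps A (kG A) (kN A)"
  unfolding kN_def kG_to_kN_def[abs_def] by (intro quot_alg_class_linear kG_algebra ideals)

lemma kN_to_kT_linear: assumes "cring A" shows "kN_to_kT A \<in> linear_maps A (kN A) (kT A)"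
proof -
  interpret kG: algebra A "kG A" by (rule kG_algebra) fact
  let ?J = "ideal_I1 A \<cdot>\<^bsub>kG A\<^esub> ideal_I2 A"
  interpret J: ideal ?J "kG A" by (rule ideals) fact
  have "?J \<subseteq> ideal_I1 A" using ring.ideal_prod_inter[OF cring.axioms(1)[OF kG.M_cring] ideals(1,2)[OF assms]] by blast
  then have "kN_to_kT A (?J +>\<^bsub>kG A\<^esub> c) = ideal_I1 A +>\<^bsub>kG A\<^esub> c" if "c \<in> carrier (kG A)" for c
    unfolding kN_to_kT_def by (intro set_add_coset ideals assms that) simp_all
  then show ?thesis unfolding kN_def linear_maps_quot_alg
    using quot_alg_class_linear[OF kG.algebra_axioms ideals(1)[OF assms]]
    by (intro linear_maps_from_quot[OF kG.module_axioms ideal_submodule[OF kG.algebra_axioms ideals(3)[OF assms]]])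
      (simp_all add: kT_def)
qed

text \<open>Each product has one off-diagonal factor, a generator of \<open>ideal_I1\<close>, and
  one diagonal factor, a generator of \<open>ideal_I2\<close>.\<close>

lemma kG_to_kN_product:
  assumes "cring A"
  shows "kG_to_kN A (kG_x A 1 1 \<otimes>\<^bsub>kG A\<^esub> kG_x A 2 1) = \<zero>\<^bsub>kN A\<^esub>"
    "kG_to_kN A (kG_x A 1 2 \<otimes>\<^bsub>kG A\<^esub> kG_x A 2 2) = \<zero>\<^bsub>kN A\<^esub>"
    "kG_to_kN A (kG_x A 1 1 \<otimes>\<^bsub>kG A\<^esub> kG_x A 1 2) = \<zero>\<^bsub>kN A\<^esub>"
    "kG_to_kN A (kG_x A 2 1 \<otimes>\<^bsub>kG A\<^esub> kG_x A 2 2) = \<zero>\<^bsub>kN A\<^esub>"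
proof -
  interpret kG: algebra A "kG A" by (rule kG_algebra) fact
  let ?J = "ideal_I1 A \<cdot>\<^bsub>kG A\<^esub> ideal_I2 A"
  interpret J: ideal ?J "kG A" by (rule ideals) fact
  interpret J: abelian_subgroup ?J "kG A" 
    by (rule submodule_abelian_subgroup[OF kG.module_axioms ideal_submodule[OF kG.algebra_axioms ideals(3)[OF assms]]])
  note x = kG_x_carrier[OF assms]
  have "kG_x A 1 2 \<in> ideal_I1 A" "kG_x A 2 1 \<in> ideal_I1 A" "kG_x A 1 1 \<in> ideal_I2 A" "kG_x A 2 2 \<in> ideal_I2 A"
    unfolding ideal_I1_def ideal_I2_def using ring.genideal_self[OF cring.axioms(1)[OF kG.M_cring], of "{_, _}"] x by auto
  note p = ideal_prod.prod[OF this(1,3)] ideal_prod.prod[OF this(1,4)] ideal_prod.prod[OF this(2,3)] ideal_prod.prod[OF this(2,4)]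
  have z: "kG_to_kN A c = \<zero>\<^bsub>kN A\<^esub>" if "c \<in> ?J" for c
    using that by (simp add: kG_to_kN_def kN_def quot_alg_simps J.a_rcos_const)
  show "kG_to_kN A (kG_x A 1 1 \<otimes>\<^bsub>kG A\<^esub> kG_x A 2 1) = \<zero>\<^bsub>kN A\<^esub>"
    "kG_to_kN A (kG_x A 1 2 \<otimes>\<^bsub>kG A\<^esub> kG_x A 2 2) = \<zero>\<^bsub>kN A\<^esub>"
    "kG_to_kN A (kG_x A 1 1 \<otimes>\<^bsub>kG A\<^esub> kG_x A 1 2) = \<zero>\<^bsub>kN A\<^esub>"
    "kG_to_kN A (kG_x A 2 1 \<otimes>\<^bsub>kG A\<^esub> kG_x A 2 2) = \<zero>\<^bsub>kN A\<^esub>"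
    using p[THEN z] cring.cring_simprules(14)[OF kG.M_cring x x] by simp_all
qed

subsection \<open>Evaluation of \<open>k[G]\<close> at an invertible matrix\<close>

text \<open>The universal property of univariate polynomials, restated for \<open>up_const\<close>
  and \<open>up_var\<close> so that it can be iterated along the tower behind
  \<open>poly_alg\<close>.\<close>

lemma UP_eval:
  assumes "cring S" "cring R" "h \<in> ring_hom S R" "s \<in> carrier R"
  obtains k where "k \<in> ring_hom (UP S) R" "\<And>a. a \<in> carrier S \<Longrightarrow> k (up_const S a) = h a" "k (up_var S) = s"
proof -
  interpret UP_pre_univ_prop S R h "UP S" by (rule UP_pre_univ_propI[OF assms(1-3)]) simp
  show ?thesis
    by (rule that[OF eval_ring_hom[OF assms(4)]])
      (simp_all add: up_const_def up_var_def eval_const eval_monom1 assms(4) del: One_nat_def)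
qed

text \<open>\<open>UP_eval\<close> is applied once per variable, in the order x_11, x_12, x_21,
  x_22, t; each stage extends the previous evaluation.\<close>

lemma poly_alg_eval:
  assumes "cring A" "\<And>i j. g i j \<in> carrier A" "u \<in> carrier A"
  shows "\<exists>h. h \<in> ring_hom (poly_alg A) A \<and> (\<forall>a\<in>carrier A. h (poly_const A a) = a) \<and>
    (\<forall>i\<in>{1, 2}. \<forall>j\<in>{1, 2}. h (poly_x A i j) = g i j) \<and> h (poly_t A) = u"
proof -
  let ?A1 = "UP A" let ?A2 = "UP ?A1" let ?A3 = "UP ?A2" let ?A4 = "UP ?A3"
  note c0 = assms(1)
  note c1 = UP_cring'[OF c0] note c2 = UP_cring'[OF c1] note c3 = UP_cring'[OF c2] note c4 = UP_cring'[OF c3]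
  obtain h1 where h1: "h1 \<in> ring_hom ?A1 A" "\<And>a. a \<in> carrier A \<Longrightarrow> h1 (up_const A a) = id a" "h1 (up_var A) = g 1 1"
    using UP_eval[OF c0 c0 id_ring_hom assms(2)] by metis
  obtain h2 where h2: "h2 \<in> ring_hom ?A2 A" "\<And>a. a \<in> carrier ?A1 \<Longrightarrow> h2 (up_const ?A1 a) = h1 a" "h2 (up_var ?A1) = g 1 2"
    using UP_eval[OF c1 c0 h1(1) assms(2)] by metis
  obtain h3 where h3: "h3 \<in> ring_hom ?A3 A" "\<And>a. a \<in> carrier ?A2 \<Longrightarrow> h3 (up_const ?A2 a) = h2 a" "h3 (up_var ?A2) = g 2 1"
    using UP_eval[OF c2 c0 h2(1) assms(2)] by metis
  obtain h4 where h4: "h4 \<in> ring_hom ?A4 A" "\<And>a. a \<in> carrier ?A3 \<Longrightarrow> h4 (up_const ?A3 a) = h3 a" "h4 (up_var ?A3) = g 2 2"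
    using UP_eval[OF c3 c0 h3(1) assms(2)] by metis
  obtain h5 where h5: "h5 \<in> ring_hom (UP ?A4) A" "\<And>a. a \<in> carrier ?A4 \<Longrightarrow> h5 (up_const ?A4 a) = h4 a" "h5 (up_var ?A4) = u"
    using UP_eval[OF c4 c0 h4(1) assms(3)] by metis
  note cl = up_carrier[OF c0] up_carrier[OF c1] up_carrier[OF c2] up_carrier[OF c3]
  note h = h1(2,3) h2(2,3) h3(2,3) h4(2,3) h5(2,3)
  have "h5 \<in> ring_hom (poly_alg A) A"
    using h5(1) by (simp add: ring_hom_def poly_alg_def Let_def ring.defs module.defs)
  then show ?thesis
    by (intro exI[of _ h5]) (auto simp: poly_const_def poly_x_def poly_t_def cl h)
qed

lemma poly_alg_smult: "a \<odot>\<^bsub>poly_alg A\<^esub> p = poly_const A a \<otimes>\<^bsub>poly_alg A\<^esub> p"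
  by (simp add: poly_alg_def Let_def ring.defs module.defs)

context comm_ring_base
begin

text \<open>The hypothesis \<open>det\<close> says that evaluation kills the generator of
  \<open>det_ideal\<close>, so it descends to k[G]. Only linearity and the values on products of two
  generators are recorded, because these are the coefficients in the coaction of the tensor square.
  \<open>SA\<close> is \<open>A\<close> as a module over itself.\<close>

lemma kG_eval:
  assumes g: "\<And>i j. g i j \<in> carrier A" and u: "u \<in> carrier A"
    and det: "u \<otimes> (g 1 1 \<otimes> g 2 2 \<ominus> g 1 2 \<otimes> g 2 1) = \<one>"
  obtains ev where "ev \<in> linear_maps A (kG A) SA"
    "\<And>i j k l. i \<in> {1, 2} \<Longrightarrow> j \<in> {1, 2} \<Longrightarrow> k \<in> {1, 2} \<Longrightarrow> l \<in> {1, 2} \<Longrightarrow>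
      ev (kG_x A i j \<otimes>\<^bsub>kG A\<^esub> kG_x A k l) = g i j \<otimes> g k l"
proof -
  let ?P = "poly_alg A"
  let ?X = "poly_x A"
  let ?I = "det_ideal A"
  interpret P: algebra A ?P by (rule poly_alg_algebra[OF A])
  obtain h where h: "h \<in> ring_hom ?P A" "\<And>a. a \<in> carrier A \<Longrightarrow> h (poly_const A a) = a"
    "\<And>i j. i \<in> {1, 2} \<Longrightarrow> j \<in> {1, 2} \<Longrightarrow> h (?X i j) = g i j" "h (poly_t A) = u"
    using poly_alg_eval[of A g u, OF A g u] by blast
  interpret h: ring_hom_cring ?P A h
    by (intro ring_hom_cring.intro ring_hom_cring_axioms.intro P.M_cring A h(1))
  interpret I: ideal ?I ?P by (rule det_ideal_ideal[OF A])
  note x = poly_x_carrier[OF A] poly_t_carrier[OF A]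
  have cc: "poly_const A a \<in> carrier ?P" if "a \<in> carrier A" for a
    using ring_hom_closed[OF poly_const_hom[OF A] that] by (simp add: poly_alg_carrier)
  have lin: "h \<in> linear_maps A ?P SA"
    by (auto simp: linear_maps_def SA_simps poly_alg_smult cc h(2))
  have hm: "h (p \<ominus>\<^bsub>?P\<^esub> q) = h p \<ominus> h q" if "p \<in> carrier ?P" "q \<in> carrier ?P" for p q
    using that by (simp add: a_minus_def)
  note cl = cring.cring_simprules(4-6)[OF P.M_cring]
  \<comment> \<open>The kernel of \<open>h\<close> is an ideal, so it suffices that it contains the
    generator tD - 1.\<close>
  have "?I \<subseteq> a_kernel ?P A h" unfolding det_ideal_def Let_def
  proof (rule ring.genideal_minimal[OF cring.axioms(1)[OF P.M_cring] ring_hom_ring.kernel_is_ideal[OF ring_hom_ringI2[OF cring.axioms(1)[OF P.M_cring] cring.axioms(1)[OF A] h(1)]]])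
    let ?D = "?X 1 1 \<otimes>\<^bsub>?P\<^esub> ?X 2 2 \<ominus>\<^bsub>?P\<^esub> ?X 1 2 \<otimes>\<^bsub>?P\<^esub> ?X 2 1"
    have d: "?D \<in> carrier ?P" "poly_t A \<otimes>\<^bsub>?P\<^esub> ?D \<in> carrier ?P" by (intro cl x)+
    have "h ?D = g 1 1 \<otimes> g 2 2 \<ominus> g 1 2 \<otimes> g 2 1"
      unfolding hm[OF cl(2)[OF x(1) x(1)] cl(2)[OF x(1) x(1)]] h.hom_mult[OF x(1) x(1)]
      by (subst (1 2 3 4) h(3)) simp_all
    then have "h (poly_t A \<otimes>\<^bsub>?P\<^esub> ?D \<ominus>\<^bsub>?P\<^esub> \<one>\<^bsub>?P\<^esub>) = \<zero>"
      unfolding hm[OF d(2) cl(3)] h.hom_mult[OF x(2) d(1)] h(4) h.hom_one using det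
      by (simp only: a_minus_def r_neg[OF one_closed])
    then show "{poly_t A \<otimes>\<^bsub>?P\<^esub> ?D \<ominus>\<^bsub>?P\<^esub> \<one>\<^bsub>?P\<^esub>} \<subseteq> a_kernel ?P A h"
      unfolding a_kernel_def' using cl(1)[OF d(2) cl(3)] by blast
  qed
  then have ker: "?I \<subseteq> {p \<in> carrier ?P. h p = \<zero>\<^bsub>SA\<^esub>}" unfolding a_kernel_def' SA_simps .
  note ql = quot_lift[OF P.module_axioms ideal_submodule[OF P.algebra_axioms I.ideal_axioms] SA.module_axioms lin ker]
  show ?thesis
  proof (rule that[of "quot_lift h"])
    show "quot_lift h \<in> linear_maps A (kG A) SA" unfolding kG_def linear_maps_quot_alg by (rule ql(1))
    fix i j k l :: nat assume i: "i \<in> {1, 2}" "j \<in> {1, 2}" "k \<in> {1, 2}" "l \<in> {1, 2}"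
    show "quot_lift h (kG_x A i j \<otimes>\<^bsub>kG A\<^esub> kG_x A k l) = g i j \<otimes> g k l"
      unfolding kG_def quot_alg_simps kG_x_def I.rcoset_mult_add[OF x(1) x(1)]
        ql(2)[OF cl(2)[OF x(1) x(1)]] h.hom_mult[OF x(1) x(1)] h(3)[OF i(1,2)] h(3)[OF i(3,4)] ..
  qed
qed

end

subsection \<open>Change of coalgebra\<close>

text \<open>Functoriality, checked on pure tensors. The composites \<open>h\<close> and
  \<open>k\<close> are separate parameters that have to agree with them on the carriers only; this
  allows \<open>polar\<close> for \<open>\<theta>\<close> after the class map.\<close>

lemma tensor_map_comp:
  assumes "module R M" "module R N" "module R K" "module R L" "module R K'" "module R L'"
    "f \<in> linear_maps R M K" "g \<in> linear_maps R N L" "f' \<in> linear_maps R K K'" "g' \<in> linear_maps R L L'"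
    "h \<in> linear_maps R M K'" "k \<in> linear_maps R N L'"
    "\<And>m. m \<in> carrier M \<Longrightarrow> f' (f m) = h m" "\<And>n. n \<in> carrier N \<Longrightarrow> g' (g n) = k n"
    and t: "t \<in> carrier (tensor_module R M N)"
  shows "tensor_map R K' L' f' g' (tensor_map R K L f g t) = tensor_map R K' L' h k t"
proof -
  interpret two_modules R M N by (intro two_modules.intro assms)
  interpret KL: two_modules R K' L' by (intro two_modules.intro assms)
  note 1 = tensor_map[OF assms(1-4,7,8)]
  note 2 = tensor_map[OF assms(3-6,9,10)]
  note 3 = tensor_map[OF assms(1,2,5,6,11,12)]
  show ?thesis
    by (rule tensor_ext[OF KL.module linear_maps_comp[OF 1(1) 2(1)] 3(1) _ t])
      (simp add: 1(2) 2(2) 3(2) linear_mapsD(1)[OF assms(7)] linear_mapsD(1)[OF assms(8)] assms(13,14))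
qed

lemma comod_along_simps:
  "carrier (comod_along R C \<pi> M) = carrier M" "zero (comod_along R C \<pi> M) = zero M"
  "add (comod_along R C \<pi> M) = add M" "smult (comod_along R C \<pi> M) = smult M"
  "coact (comod_along R C \<pi> M) = (\<lambda>m. tensor_map R M C id \<pi> (coact M m))"
  by (simp_all add: comod_along_def module.defs comod.defs)

lemma tensor_comod_along:
  "tensor_module R (comod_along R C \<pi> M) D = tensor_module R M D"
  "pure_tensor R (comod_along R C \<pi> M) D = pure_tensor R M D"
  "tensor_map R (comod_along R C \<pi> M) D f g = tensor_map R M D f g"
  using tensor_module_cong[of "comod_along R C \<pi> M" M D D R]
  by (simp_all add: tensor_map_def comod_along_simps)

text \<open>Applying \<open>\<phi>\<close> to the left factor commutes with applying
  \<open>\<pi>\<close> to the right factor: both orders give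
  \<open>tensor_map R N D \<phi> \<pi>\<close>.\<close>

lemma comod_iso_along:
  assumes "module R M" "module R N" "module R C" "module R D" "\<pi> \<in> linear_maps R C D"
    "\<And>m. m \<in> carrier M \<Longrightarrow> coact M m \<in> carrier (tensor_module R M C)"
    and \<phi>: "\<phi> \<in> comod_iso R C M N"
  shows "\<phi> \<in> comod_iso R D (comod_along R D \<pi> M) (comod_along R D \<pi> N)"
proof -
  have l: "\<phi> \<in> linear_maps R M N" using \<phi> by (simp add: comod_iso_def)
  have "tensor_map R N D id \<pi> (tensor_map R N C \<phi> id t) = tensor_map R N D \<phi> \<pi> t"
    and "tensor_map R N D \<phi> id (tensor_map R M D id \<pi> t) = tensor_map R N D \<phi> \<pi> t"
    if "t \<in> carrier (tensor_module R M C)" for t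
    using that
    by (intro tensor_map_comp[of R M C] assms(1-5) l linear_maps_id(2); simp)+
  then show ?thesis using \<phi> assms(6)
    by (auto simp: comod_iso_def comod_along_simps tensor_comod_along linear_maps_def)
qed

context comm_ring_base
begin

subsection \<open>Bases of \<open>Sym\<^sup>2 V\<close> and \<open>S\<^sub>2 V\<close>\<close>

lemma linear_VV_expand:
  assumes "module A X" "f \<in> linear_maps A VV.MN X" "t \<in> carrier VV.MN"
  shows "f t = (cc 1 1 t \<odot>\<^bsub>X\<^esub> f (ee 1 1) \<oplus>\<^bsub>X\<^esub> cc 1 2 t \<odot>\<^bsub>X\<^esub> f (ee 1 2))
    \<oplus>\<^bsub>X\<^esub> (cc 2 1 t \<odot>\<^bsub>X\<^esub> f (ee 2 1) \<oplus>\<^bsub>X\<^esub> cc 2 2 t \<odot>\<^bsub>X\<^esub> f (ee 2 2))"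
proof -
  interpret X: module A X by fact
  have "cc i j t \<odot>\<^bsub>VV.MN\<^esub> ee k l \<in> carrier VV.MN" if "k \<in> {1, 2}" "l \<in> {1, 2}" for i j k l
    using assms(3) cc_closed ee_closed[OF that] by simp
  note c = this[of 1 1, simplified] this[of 1 2, simplified] this[of 2 1, simplified] this[of 2 2, simplified]
  show ?thesis
    by (subst VV_expand[OF assms(3)])
      (simp add: c linear_mapsD[OF assms(2)] cc_closed[OF assms(3)])
qed

lemma linear_VV_ext:
  assumes "module A X" "f \<in> linear_maps A VV.MN X" "g \<in> linear_maps A VV.MN X"
    "f (ee 1 1) = g (ee 1 1)" "f (ee 1 2) = g (ee 1 2)" "f (ee 2 1) = g (ee 2 1)" "f (ee 2 2) = g (ee 2 2)"
    "t \<in> carrier VV.MN"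
  shows "f t = g t"
  unfolding linear_VV_expand[OF assms(1,2,8)] linear_VV_expand[OF assms(1,3,8)] assms(4-7) ..

lemma cc_ee: "cc i j (ee k l) = (if k = i \<and> l = j then \<one> else \<zero>)" if "k \<in> {1, 2}" "l \<in> {1, 2}"
  by (subst cc(2)) (use that e_carrier in \<open>auto simp: unit_vec_def\<close>)

lemma cc_linear:
  "x \<in> carrier VV.MN \<Longrightarrow> y \<in> carrier VV.MN \<Longrightarrow> cc i j (x \<oplus>\<^bsub>VV.MN\<^esub> y) = cc i j x \<oplus> cc i j y"
  "a \<in> carrier A \<Longrightarrow> x \<in> carrier VV.MN \<Longrightarrow> cc i j (a \<odot>\<^bsub>VV.MN\<^esub> x) = a \<otimes> cc i j x"
  using linear_mapsD[OF cc(1)] by (simp_all add: SA_simps)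

abbreviation "Q \<equiv> quot_module (VV_comod A) U"
abbreviation "class t \<equiv> U +>\<^bsub>VV_comod A\<^esub> t"
abbreviation "D \<equiv> coact (VV_comod A)"

lemma class_linear: "(\<lambda>t. class t) \<in> linear_maps A VV.MN Q"
  using quot_class_linear[OF VV_module U] unfolding lin_VV .

lemma Q_E:
  assumes "X \<in> carrier Q" obtains t where "t \<in> carrier VV.MN" "X = class t"
  using assms by (elim quot_carrierE) (simp add: VV_simps)

lemma D_linear: "D \<in> linear_maps A VV.MN VV.P"
  using VV_coact unfolding lin_VV tensor_VV .

lemma linear_maps_S: "f \<in> linear_maps A VV.MN S \<longleftrightarrow> f \<in> linear_maps A VV.MN VV.MN \<and> f ` carrier VV.MN \<subseteq> symt"
  by (auto simp: linear_maps_def VV_simps)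

text \<open>\<open>polar\<close> induces the isomorphism from the symmetric square to the symmetric tensors, and \<open>upper\<close>
  its inverse.\<close>

definition "polar t = (cc 1 1 t \<odot>\<^bsub>VV.MN\<^esub> ee 1 1 \<oplus>\<^bsub>VV.MN\<^esub> cc 1 2 t \<odot>\<^bsub>VV.MN\<^esub> ss) \<oplus>\<^bsub>VV.MN\<^esub>
    (cc 2 1 t \<odot>\<^bsub>VV.MN\<^esub> ss \<oplus>\<^bsub>VV.MN\<^esub> cc 2 2 t \<odot>\<^bsub>VV.MN\<^esub> ee 2 2)"

definition "upper t = cc 1 1 t \<odot>\<^bsub>VV.MN\<^esub> ee 1 1 \<oplus>\<^bsub>VV.MN\<^esub>
    (cc 1 2 t \<odot>\<^bsub>VV.MN\<^esub> ee 1 2 \<oplus>\<^bsub>VV.MN\<^esub> cc 2 2 t \<odot>\<^bsub>VV.MN\<^esub> ee 2 2)"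

lemma polar_ee: "polar (ee 1 1) = ee 1 1" "polar (ee 1 2) = ss" "polar (ee 2 1) = ss" "polar (ee 2 2) = ee 2 2"
  and upper_ee: "upper (ee 1 1) = ee 1 1" "upper (ee 1 2) = ee 1 2" "upper (ee 2 1) = \<zero>\<^bsub>VV.MN\<^esub>" "upper (ee 2 2) = ee 2 2"
  and retr_ee: "retr (ee 1 1) = ee 1 1" "retr (ee 1 2) = ss" "retr (ee 2 1) = \<zero>\<^bsub>VV.MN\<^esub>" "retr (ee 2 2) = ee 2 2"
  by (simp_all add: polar_def upper_def retr_def cc_ee)

lemma polar_linear: "polar \<in> linear_maps A VV.MN VV.MN" and upper_linear: "upper \<in> linear_maps A VV.MN VV.MN"
  unfolding polar_def[abs_def] upper_def[abs_def]
  by (intro linear_sum_smult VV.MN.module cc_smult; simp)+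

lemma polar_sym: "t \<in> carrier VV.MN \<Longrightarrow> polar t \<in> symt"
  unfolding sym_simps polar_def
  by (simp add: cc_closed linear_mapsD[OF swap(1)] swap(2) VV.MN.T.M.a_comm)

lemma polar_linear_S: "polar \<in> linear_maps A VV.MN S"
  using polar_linear polar_sym by (auto simp: linear_maps_S)

text \<open>\<open>polar\<close> multiplies the same tensor \<open>ss\<close> by
  \<open>cc 1 2\<close> and by \<open>cc 2 1\<close>, so it cannot distinguish the two orders of a
  pure tensor.\<close>

lemma polar_U: "U \<subseteq> {u \<in> carrier (VV_comod A). polar u = \<zero>\<^bsub>S\<^esub>}"
proof (rule span_least[OF eq_submodule[OF VV_module S.module_axioms]])
  show "polar \<in> linear_maps A (VV_comod A) S" unfolding lin_VV by (rule polar_linear_S)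
  show "(\<lambda>_. \<zero>\<^bsub>S\<^esub>) \<in> linear_maps A (VV_comod A) S"
    using S.M.zero_closed by (auto simp: linear_maps_def simp del: S_carrier)
  have "polar (VV.MN.pt v w) = polar (VV.MN.pt w v)" if "v \<in> carrier V" "w \<in> carrier V" for v w
    using that V_coord by (simp add: polar_def cc(2) VV.MN.T.M.a_ac m_comm)
  note sw = this
  note L = polar_linear[folded lin_VV]
  show "sym_rels \<subseteq> {u \<in> carrier (VV_comod A). polar u = \<zero>\<^bsub>S\<^esub>}"
  proof clarify
    fix v w assume vw: "v \<in> carrier V" "w \<in> carrier V"
    have p: "VV.MN.pt v w \<in> carrier (VV_comod A)" "VV.MN.pt w v \<in> carrier (VV_comod A)"
      unfolding VV_simps by (intro VV.MN.pt_closed vw)+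
    have "polar (VV.MN.pt v w \<ominus>\<^bsub>VV_comod A\<^esub> VV.MN.pt w v) = \<zero>\<^bsub>VV_comod A\<^esub>"
      unfolding linear_maps_uminus(3)[OF VV_module VV_module L p] sw[OF vw]
      using W.M.r_neg[OF linear_mapsD(1)[OF L p(2)]] by (simp only: a_minus_def)
    with W.M.minus_closed[OF p]
    show "VV.MN.pt v w \<ominus>\<^bsub>VV_comod A\<^esub> VV.MN.pt w v \<in> carrier (VV_comod A) \<and>
        polar (VV.MN.pt v w \<ominus>\<^bsub>VV_comod A\<^esub> VV.MN.pt w v) = \<zero>\<^bsub>S\<^esub>" by simp
  qed
qed

definition "\<theta> = quot_lift polar"

lemma \<theta>: "\<theta> \<in> linear_maps A Q S" "t \<in> carrier VV.MN \<Longrightarrow> \<theta> (class t) = polar t"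
  using quot_lift[OF VV_module U S.module_axioms polar_linear_S[folded lin_VV] polar_U]
  by (simp_all add: \<theta>_def VV_simps)

text \<open>The inverse sends a symmetric \<open>t\<close> to the class of \<open>upper t\<close>.
  As \<open>upper\<close> drops the coordinate at \<open>ee 2 1\<close>, it sends \<open>ss\<close>
  to \<open>ee 1 2\<close> and not to a representative of twice its class; hence no division by 2
  occurs.\<close>

lemma \<theta>_bij: "bij_betw \<theta> (carrier Q) symt"
proof (rule bij_betw_byWitness[of _ "\<lambda>t. class (upper t)"])
  have "class (upper (polar t)) = class t" if "t \<in> carrier VV.MN" for t
  proof (rule linear_VV_ext[OF Q.module_axioms _ class_linear _ _ _ _ that])
    show "(\<lambda>t. class (upper (polar t))) \<in> linear_maps A VV.MN Q"
      by (intro linear_maps_comp[OF linear_maps_comp[OF polar_linear upper_linear] class_linear])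
    have "upper ss = ee 1 2"
      using linear_mapsD(2)[OF upper_linear, of "ee 1 2" "ee 2 1"] by (simp add: upper_ee[unfolded One_nat_def])
    then show "class (upper (polar (ee 1 1))) = class (ee 1 1)" "class (upper (polar (ee 1 2))) = class (ee 1 2)"
      "class (upper (polar (ee 2 1))) = class (ee 2 1)" "class (upper (polar (ee 2 2))) = class (ee 2 2)"
      using class_swap[OF e_carrier e_carrier, of 1 2] by (simp_all only: polar_ee upper_ee insert_iff simp_thms)
  qed
  then show "\<forall>X\<in>carrier Q. class (upper (\<theta> X)) = X"
    by (auto elim!: Q_E simp: \<theta>(2) simp del: quot_module_simps)
  have up: "upper t \<in> carrier VV.MN" if "t \<in> carrier VV.MN" for t by (rule linear_mapsD(1)[OF upper_linear that])
  \<comment> \<open>\<open>retr\<close> is the identity on symmetric tensors, so this settles the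
    second composite.\<close>
  have "polar (upper t) = retr t" if "t \<in> carrier VV.MN" for t
  proof (rule linear_VV_ext[OF VV.MN.module linear_maps_comp[OF upper_linear polar_linear] retr _ _ _ _ that])
    show "polar (upper (ee 1 1)) = retr (ee 1 1)" "polar (upper (ee 1 2)) = retr (ee 1 2)"
      "polar (upper (ee 2 1)) = retr (ee 2 1)" "polar (upper (ee 2 2)) = retr (ee 2 2)"
      using linear_maps_uminus(1)[OF VV.MN.module VV.MN.module polar_linear]
      by (simp_all only: polar_ee upper_ee retr_ee)
  qed
  then show "\<forall>t\<in>symt. \<theta> (class (upper t)) = t"
    using symD retr_id by (auto simp: \<theta>(2) up)
  show "\<theta> ` carrier Q \<subseteq> symt" using linear_mapsD(1)[OF \<theta>(1)] by auto
  show "(\<lambda>t. class (upper t)) ` symt \<subseteq> carrier Q"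
    using linear_mapsD(1)[OF class_linear] up symD by (auto simp del: quot_module_simps)
qed

subsection \<open>The coactions\<close>

lemma Sym2_simps:
  "carrier (Sym2_comod A) = carrier Q" "zero (Sym2_comod A) = zero Q"
  "add (Sym2_comod A) = add Q" "smult (Sym2_comod A) = smult Q"
  unfolding Sym2_eq quot_comod_simps by (rule refl)+

lemma S2_simps:
  "carrier (S2_comod A) = symt" "zero (S2_comod A) = zero S"
  "add (S2_comod A) = add S" "smult (S2_comod A) = smult S"
  by (simp_all add: S2_comod_def sub_comod_def module.defs comod.defs)

lemma tensor_Sym2:
  "tensor_module A (Sym2_comod A) C = tensor_module A Q C" "tensor_map A (Sym2_comod A) C f g = tensor_map A Q C f g"
  using tensor_module_cong[of "Sym2_comod A" Q C C A] by (simp_all add: Sym2_simps tensor_map_def)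

lemma tensor_S2:
  "tensor_module A (S2_comod A) C = tensor_module A S C" "tensor_map A (S2_comod A) C f g = tensor_map A S C f g"
  using tensor_module_cong[of "S2_comod A" S C C A] by (simp_all add: S2_simps tensor_map_def)

lemma linear_maps_Sym2_S2: "linear_maps A (Sym2_comod A) (S2_comod A) = linear_maps A Q S"
  by (simp add: linear_maps_def Sym2_simps S2_simps)

lemma Sym2_module: "module A (Sym2_comod A)"
  by (rule module_transfer[OF Q.module_axioms]) (simp_all add: Sym2_simps)

lemma S2_module: "module A (S2_comod A)"
  by (rule module_transfer[OF S.module_axioms]) (simp_all add: S2_simps)

lemma Sym2_coact_class: "t \<in> carrier VV.MN \<Longrightarrow> coact (Sym2_comod A) (class t) = q (D t)"
  unfolding Sym2_eq
  by (rule quot_comod_coact[OF VV_module kG.module_axioms U VV_coact U_stable]) (simp_all add: VV_simps)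

text \<open>Since \<open>\<rho>\<close> is a left inverse of \<open>\<iota>\<close>, the definite
  description in \<open>sub_comod\<close> can be replaced by an explicit formula.\<close>

lemma S2_coact_\<rho>: assumes "t \<in> symt" shows "coact (S2_comod A) t = \<rho> (D t)"
proof -
  note c = S2_coact(1,2)[of t, unfolded S2_simps, OF assms]
  show ?thesis using \<rho>\<iota>[OF c(1)] unfolding c(2) by simp
qed

text \<open>Both sides are pulled back to the tensor square. At the class of \<open>t\<close>, the
  coaction after \<open>\<theta>\<close> becomes \<open>?G retr (D (polar t))\<close>, and
  \<open>\<theta>\<close> applied after the coaction becomes \<open>?G polar (D t)\<close>. By
  linearity these are compared on the four basis tensors.\<close>

lemma \<theta>_iso_N: "\<theta> \<in> comod_iso A (kN A) (res_N A (Sym2_comod A)) (res_N A (S2_comod A))"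
proof -
  interpret kN: algebra A "kN A" by (rule kN_algebra[OF A])
  interpret SN: two_modules A S "kN A" by (intro two_modules.intro S.module_axioms kN.module_axioms)
  let ?\<pi> = "kG_to_kN A"
  let ?G = "\<lambda>f. tensor_map A S (kN A) f ?\<pi>"
  note \<pi> = kG_to_kN_linear[OF A]
  note R = lin_S(1)[unfolded lin_VV]
  note P = polar_linear_S
  note G = tensor_map[OF VV.MN.module kG.module_axioms S.module_axioms kN.module_axioms _ \<pi>]
  have G_ee: "?G f (D (ee a b)) =
      (SN.pt (f (ee 1 1)) (?\<pi> (gx 1 a \<otimes>\<^bsub>kG A\<^esub> gx 1 b)) \<oplus>\<^bsub>SN.T\<^esub> SN.pt (f (ee 1 2)) (?\<pi> (gx 1 a \<otimes>\<^bsub>kG A\<^esub> gx 2 b)))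
      \<oplus>\<^bsub>SN.T\<^esub> (SN.pt (f (ee 2 1)) (?\<pi> (gx 2 a \<otimes>\<^bsub>kG A\<^esub> gx 1 b)) \<oplus>\<^bsub>SN.T\<^esub> SN.pt (f (ee 2 2)) (?\<pi> (gx 2 a \<otimes>\<^bsub>kG A\<^esub> gx 2 b)))"
    if f: "f \<in> linear_maps A VV.MN S" and ab: "a \<in> {1, 2}" "b \<in> {1, 2}" for f a b
  proof -
    have p: "pe i j k l m n \<in> carrier VV.P" "?G f (pe i j k l m n) = SN.pt (f (ee i j)) (?\<pi> (gx k l \<otimes>\<^bsub>kG A\<^esub> gx m n))"
      if "i \<in> {1, 2}" "j \<in> {1, 2}" for i j k l m n
      by (intro VV.P.pt_closed ee_closed that xx) (rule G(2)[OF f ee_closed[OF that] xx])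
    have i: "1 \<in> {1, 2::nat}" "2 \<in> {1, 2::nat}" by simp_all
    note p = p[OF i(1) i(1)] p[OF i(1) i(2)] p[OF i(2) i(1)] p[OF i(2) i(2)]
    note L = linear_mapsD(2)[OF G(1)[OF f]]
    show ?thesis unfolding coact_ee[OF ab]
      by (simp only: L p VV.P.T.M.a_closed)
  qed
  have z: "SN.pt t \<zero>\<^bsub>kN A\<^esub> = \<zero>\<^bsub>SN.T\<^esub>" if "t \<in> carrier S" for t
    using SN.pt_smult_r[OF zero_closed that kN.M.zero_closed] SN.pt_closed[OF that kN.M.zero_closed] by simp
  \<comment> \<open>Needed because \<open>retr\<close> sends \<open>ee 2 1\<close> to zero.\<close>
  have z': "SN.pt \<zero>\<^bsub>VV.MN\<^esub> c = \<zero>\<^bsub>SN.T\<^esub>" if "c \<in> carrier (kN A)" for c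
  proof -
    have "\<zero>\<^bsub>S\<^esub> = \<zero>\<^bsub>VV.MN\<^esub>" by (simp add: VV_simps)
    then show ?thesis
      using SN.pt_smult_l[OF zero_closed S.M.zero_closed that] SN.T.smult_l_null[OF SN.pt_closed[OF S.M.zero_closed that]]
        S.smult_l_null[OF S.M.zero_closed] by (simp only:)
  qed
  have s: "ee 1 1 \<in> carrier S" "ee 2 2 \<in> carrier S" "ss \<in> carrier S"
    using polar_sym[of "ee 1 1"] polar_sym[of "ee 2 2"] polar_sym[of "ee 1 2"] unfolding polar_ee S_carrier by simp_all
  have c: "gx a b \<otimes>\<^bsub>kG A\<^esub> gx c d = gx c d \<otimes>\<^bsub>kG A\<^esub> gx a b" for a b c d
    by (rule VV.C_ring(2)) (rule kG_x_carrier[OF A])+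
  note \<pi>0 = kG_to_kN_product[OF A]
  note \<pi>0' = \<pi>0[unfolded c[of 1 1] c[of 1 2 2 2] c[of 2 1 2 2]]
  have pc: "?\<pi> (gx a b \<otimes>\<^bsub>kG A\<^esub> gx c d) \<in> carrier (kN A)" for a b c d by (rule linear_mapsD(1)[OF \<pi> xx])
  have tc: "SN.pt t (?\<pi> (gx a b \<otimes>\<^bsub>kG A\<^esub> gx c d)) \<in> carrier SN.T" if "t \<in> carrier S" for t a b c d
    by (rule SN.pt_closed[OF that pc])
  have i: "1 \<in> {1, 2::nat}" "2 \<in> {1, 2::nat}" by simp_all
  note GR = G_ee[OF R, unfolded retr_ee]
  note GP = G_ee[OF P, unfolded polar_ee]
  note simps = z z' s kN.M.zero_closed tc pc \<pi>0 \<pi>0' SN.T.M.l_zero SN.T.M.r_zero SN.T.M.a_closed SN.T.M.zero_closed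
  have main: "?G retr (D (polar t)) = ?G polar (D t)" if "t \<in> carrier VV.MN" for t
  proof (rule linear_VV_ext[OF SN.module _ _ _ _ _ _ that])
    show GD: "(\<lambda>t. ?G polar (D t)) \<in> linear_maps A VV.MN SN.T"
      by (rule linear_maps_comp[OF D_linear G(1)[OF P]])
    have RD: "(\<lambda>t. ?G retr (D t)) \<in> linear_maps A VV.MN SN.T"
      by (rule linear_maps_comp[OF D_linear G(1)[OF R]])
    show "(\<lambda>t. ?G retr (D (polar t))) \<in> linear_maps A VV.MN SN.T"
      by (rule linear_maps_comp[OF polar_linear RD])
    show "?G retr (D (polar (ee 1 1))) = ?G polar (D (ee 1 1))"
      "?G retr (D (polar (ee 2 2))) = ?G polar (D (ee 2 2))"
      unfolding polar_ee GR[OF i(1) i(1)] GP[OF i(1) i(1)] GR[OF i(2) i(2)] GP[OF i(2) i(2)]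
      by (simp_all only: simps)
    \<comment> \<open>In k[N] the coefficients of \<open>ee 1 1\<close> and \<open>ee 2 2\<close>
      vanish, and both sides become \<open>ss\<close> tensored with the class of x_11 x_22 plus
      \<open>ss\<close> tensored with the class of x_12 x_21.\<close>
    have "?G retr (D ss) = ?G retr (D (ee 1 2)) \<oplus>\<^bsub>SN.T\<^esub> ?G retr (D (ee 2 1))"
      by (rule linear_mapsD(2)[OF RD]) simp_all
    then show "?G retr (D (polar (ee 1 2))) = ?G polar (D (ee 1 2))"
      "?G retr (D (polar (ee 2 1))) = ?G polar (D (ee 2 1))"
      unfolding polar_ee GR[OF i(1) i(2)] GP[OF i(1) i(2)] GR[OF i(2) i(1)] GP[OF i(2) i(1)]
      by (simp_all only: simps c[of 2 2 1 1] c[of 1 2 2 1], simp_all only: simps SN.T.M.a_comm)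
  qed
  have Sym: "coact (res_N A (Sym2_comod A)) (class t) = tensor_map A Q (kN A) (\<lambda>t. class t) ?\<pi> (D t)"
    if t: "t \<in> carrier VV.MN" for t
    unfolding res_N_def comod_along_simps tensor_Sym2 Sym2_coact_class[OF t]
    by (rule tensor_map_comp[OF VV.MN.module kG.module_axioms Q.module_axioms kG.module_axioms
          Q.module_axioms kN.module_axioms class_linear linear_maps_id(2) linear_maps_id(2) \<pi> class_linear \<pi>])
      (simp_all add: linear_mapsD(1)[OF D_linear t])
  have S2: "coact (res_N A (S2_comod A)) t = ?G retr (D t)" if t: "t \<in> symt" for t
    unfolding res_N_def comod_along_simps tensor_S2 S2_coact_\<rho>[OF t]
    by (rule tensor_map_comp[OF VV.MN.module kG.module_axioms S.module_axioms kG.module_axioms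
          S.module_axioms kN.module_axioms R linear_maps_id(2) linear_maps_id(2) \<pi> R \<pi>])
      (use linear_mapsD(1)[OF D_linear symD[OF t]] in simp_all)
  have "coact (res_N A (S2_comod A)) (\<theta> X) = tensor_map A (res_N A (S2_comod A)) (kN A) \<theta> id (coact (res_N A (Sym2_comod A)) X)"
    if X: "X \<in> carrier Q" for X
  proof -
    obtain t where t: "t \<in> carrier VV.MN" "X = class t" using X by (rule Q_E)
    have "coact (res_N A (S2_comod A)) (\<theta> X) = ?G polar (D t)"
      unfolding t(2) \<theta>(2)[OF t(1)] S2[OF polar_sym[OF t(1)]] by (rule main[OF t(1)])
    \<comment> \<open>\<open>polar\<close> is \<open>\<theta>\<close> after the class map, so the
      tensor map factors through the coaction of the symmetric square.\<close>
    also have "\<dots> = tensor_map A S (kN A) \<theta> id (tensor_map A Q (kN A) (\<lambda>t. class t) ?\<pi> (D t))"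
      by (rule tensor_map_comp[OF VV.MN.module kG.module_axioms Q.module_axioms kN.module_axioms
          S.module_axioms kN.module_axioms class_linear \<pi> \<theta>(1) linear_maps_id(2) P \<pi>, symmetric])
        (simp_all add: linear_mapsD(1)[OF D_linear t(1)] \<theta>(2))
    finally show ?thesis
      unfolding t(2) Sym[OF t(1)] by (simp only: res_N_def tensor_comod_along tensor_S2)
  qed
  moreover have "\<theta> \<in> linear_maps A (res_N A (Sym2_comod A)) (res_N A (S2_comod A))"
    using \<theta>(1)[folded linear_maps_Sym2_S2] by (simp add: linear_maps_def res_N_def comod_along_simps)
  ultimately show ?thesis using \<theta>_bij
    unfolding comod_iso_def by (simp add: res_N_def comod_along_simps Sym2_simps S2_simps del: quot_module_simps)
qed

text \<open>\<open>res_T\<close> extends \<open>res_N\<close> along \<open>kN_to_kT\<close>, so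
  \<open>comod_iso_along\<close> transports \<open>\<theta>_iso_N\<close>; the same map serves for N
  and for T.\<close>

lemma \<theta>_iso_T: "\<theta> \<in> comod_iso A (kT A) (res_T A (Sym2_comod A)) (res_T A (S2_comod A))"
proof -
  have m: "module A (res_N A M)" if "module A M" for M :: "('a, 'm, 'a poly5 set) comod"
    by (rule module_transfer[OF that]) (simp_all add: res_N_def comod_along_simps)
  interpret kN: algebra A "kN A" by (rule kN_algebra[OF A])
  interpret kT: algebra A "kT A" by (rule kT_algebra[OF A])
  have "coact (res_N A (Sym2_comod A)) X \<in> carrier (tensor_module A (res_N A (Sym2_comod A)) (kN A))"
    if X: "X \<in> carrier (res_N A (Sym2_comod A))" for X
  proof -
    obtain t where t: "t \<in> carrier VV.MN" "X = class t"
      using X unfolding res_N_def comod_along_simps Sym2_simps by (rule Q_E)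
    have "q (D t) \<in> carrier QC.T" by (rule linear_mapsD(1)[OF q(1) linear_mapsD(1)[OF D_linear t(1)]])
    then show ?thesis
      unfolding t(2) res_N_def comod_along_simps tensor_comod_along tensor_Sym2 Sym2_coact_class[OF t(1)]
      by (rule linear_mapsD(1)[OF tensor_map(1)[OF Q.module_axioms kG.module_axioms Q.module_axioms kN.module_axioms
            linear_maps_id(2) kG_to_kN_linear[OF A]]])
  qed
  then show ?thesis unfolding res_T_def
    by (intro comod_iso_along[where C = "kN A"] m Sym2_module S2_module kN.module_axioms kT.module_axioms
        kN_to_kT_linear A \<theta>_iso_N)
qed

subsection \<open>Evaluating a comodule homomorphism at an invertible matrix\<close>

text \<open>\<open>c i j k l\<close> is an entry of the matrix of \<open>\<phi>\<close> on basis
  tensors. The identity arises by taking, in the comodule equation at the class of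
  \<open>ee 1 1\<close>, the coefficient of \<open>ee 1 2\<close> and evaluating it at the matrix
  \<open>g\<close>, whose determinant has inverse \<open>u\<close>.\<close>

lemma Sym2_S2_hom_eval:
  fixes g :: "nat \<Rightarrow> nat \<Rightarrow> 'a"
  assumes \<phi>: "\<phi> \<in> comod_iso A (kG A) (Sym2_comod A) (S2_comod A)"
    and g: "\<And>i j. g i j \<in> carrier A" "u \<in> carrier A" "u \<otimes> (g 1 1 \<otimes> g 2 2 \<ominus> g 1 2 \<otimes> g 2 1) = \<one>"
  defines "c \<equiv> \<lambda>i j k l. cc i j (\<phi> (class (ee k l)))"
  shows "(c 1 1 1 1 \<otimes> (g 1 1 \<otimes> g 2 1) \<oplus> c 1 2 1 1 \<otimes> (g 1 1 \<otimes> g 2 2))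
      \<oplus> (c 2 1 1 1 \<otimes> (g 1 2 \<otimes> g 2 1) \<oplus> c 2 2 1 1 \<otimes> (g 1 2 \<otimes> g 2 2))
    = (c 1 2 1 1 \<otimes> (g 1 1 \<otimes> g 1 1) \<oplus> c 1 2 1 2 \<otimes> (g 1 1 \<otimes> g 2 1))
      \<oplus> (c 1 2 2 1 \<otimes> (g 2 1 \<otimes> g 1 1) \<oplus> c 1 2 2 2 \<otimes> (g 2 1 \<otimes> g 2 1))"
proof -
  obtain ev where ev: "ev \<in> linear_maps A (kG A) SA"
    "\<And>i j k l. i \<in> {1, 2} \<Longrightarrow> j \<in> {1, 2} \<Longrightarrow> k \<in> {1, 2} \<Longrightarrow> l \<in> {1, 2} \<Longrightarrow>
      ev (gx i j \<otimes>\<^bsub>kG A\<^esub> gx k l) = g i j \<otimes> g k l"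
    using kG_eval[OF g] by blast
  have evc: "ev c \<in> carrier A" if "c \<in> carrier (kG A)" for c
    using linear_mapsD(1)[OF ev(1) that] by (simp add: SA_simps)
  have b: "(\<lambda>t c. cc 1 2 t \<otimes> ev c) \<in> bilinear_maps A VV.MN (kG A) SA"
    using linear_mapsD(2,3)[OF ev(1)] cc_linear
    by (auto simp: bilinear_maps_def linear_maps_def SA_simps cc_closed evc l_distr r_distr m_assoc m_lcomm)
  \<comment> \<open>\<open>L\<close> reads off the k[G]-coefficient of \<open>ee 1 2\<close> and
    evaluates it at \<open>g\<close>.\<close>
  define L where "L = tensor_lift A SA (\<lambda>(t :: ('a, nat \<Rightarrow> 'a, nat \<Rightarrow> 'a) tensor) c. cc 1 2 t \<otimes> ev c)"
  note L = VV.P.tensor_lift_linear[OF SA.module b, folded L_def] VV.P.tensor_lift_pt[OF SA.module b, folded L_def]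
  have i: "1 \<in> {1, 2::nat}" "2 \<in> {1, 2::nat}" by simp_all
  let ?\<Phi> = "\<lambda>t. \<phi> (class t)"
  have \<phi>l: "\<phi> \<in> linear_maps A Q S" using \<phi> by (simp add: comod_iso_def linear_maps_Sym2_S2)
  have \<Phi>: "?\<Phi> \<in> linear_maps A VV.MN S" by (rule linear_maps_comp[OF class_linear \<phi>l])
  then have \<Phi>': "?\<Phi> \<in> linear_maps A VV.MN VV.MN" and \<Phi>s: "t \<in> carrier VV.MN \<Longrightarrow> ?\<Phi> t \<in> symt" for t
    by (auto simp: linear_maps_S)
  let ?T = "\<lambda>f. tensor_map A (VV_comod A) (kG A) f id"
  \<comment> \<open>Pushing the comodule equation forward along \<open>\<iota>\<close> moves it into
    the tensor product on which \<open>L\<close> is defined.\<close>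
  have D\<Phi>: "D (?\<Phi> t) = ?T ?\<Phi> (D t)" if t: "t \<in> carrier VV.MN" for t
  proof -
    have cQ: "class t \<in> carrier Q" by (rule linear_mapsD(1)[OF class_linear t])
    have "D (?\<Phi> t) = \<iota> (coact (S2_comod A) (?\<Phi> t))"
      by (rule S2_coact(2)[symmetric]) (use \<Phi>s[OF t] in \<open>simp only: S2_simps\<close>)
    also have "coact (S2_comod A) (?\<Phi> t) = tensor_map A S (kG A) \<phi> id (q (D t))"
      using \<phi> cQ unfolding comod_iso_def
      by (simp add: Sym2_simps tensor_S2 Sym2_coact_class[OF t] del: quot_module_simps)
    also have "tensor_map A S (kG A) \<phi> id (q (D t)) = tensor_map A S (kG A) ?\<Phi> id (D t)"
      by (rule tensor_map_comp[OF VV.MN.module kG.module_axioms Q.module_axioms kG.module_axioms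
          S.module_axioms kG.module_axioms class_linear linear_maps_id(2) \<phi>l linear_maps_id(2) \<Phi> linear_maps_id(2)])
        (simp_all add: linear_mapsD(1)[OF D_linear t])
    also have "\<iota> \<dots> = ?T ?\<Phi> (D t)"
      by (rule tensor_map_comp[OF VV.MN.module kG.module_axioms S.module_axioms kG.module_axioms
          VV_module kG.module_axioms \<Phi> linear_maps_id(2) lin_S(2) linear_maps_id(2) \<Phi>'[folded lin_VV(2)] linear_maps_id(2)])
        (simp_all add: linear_mapsD(1)[OF D_linear t])
    finally show ?thesis .
  qed
  \<comment> \<open>Used twice: \<open>?\<Phi>\<close> gives the right side of the claim, and the
    identity gives the coefficient of \<open>ee 1 2\<close> in \<open>D (ee a b)\<close>, from which
    the left side is assembled.\<close>
  have Lf: "L (?T f (D (ee a b))) = (cc 1 2 (f (ee 1 1)) \<otimes> (g 1 a \<otimes> g 1 b) \<oplus> cc 1 2 (f (ee 1 2)) \<otimes> (g 1 a \<otimes> g 2 b))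
      \<oplus> (cc 1 2 (f (ee 2 1)) \<otimes> (g 2 a \<otimes> g 1 b) \<oplus> cc 1 2 (f (ee 2 2)) \<otimes> (g 2 a \<otimes> g 2 b))"
    if f: "f \<in> linear_maps A VV.MN VV.MN" and ab: "a \<in> {1, 2}" "b \<in> {1, 2}" for f a b
  proof -
    note T = tensor_map[OF VV.MN.module kG.module_axioms VV_module kG.module_axioms f[folded lin_VV(2)] linear_maps_id(2),
        unfolded tensor_VV]
    note TL = linear_maps_comp[OF T(1) L(1)]
    have p: "pe k l m a n b \<in> carrier VV.P" "L (?T f (pe k l m a n b)) = cc 1 2 (f (ee k l)) \<otimes> (g m a \<otimes> g n b)"
      if "k \<in> {1, 2}" "l \<in> {1, 2}" "m \<in> {1, 2}" "n \<in> {1, 2}" for k l m n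
      by (intro VV.P.pt_closed ee_closed xx that)
        (simp only: T(2) L(2) ev(2) ab that xx ee_closed linear_mapsD(1)[OF f] id_apply)
    note p = p[OF i(1) i(1) i(1) i(1)] p[OF i(1) i(2) i(1) i(2)] p[OF i(2) i(1) i(2) i(1)] p[OF i(2) i(2) i(2) i(2)]
    show ?thesis unfolding coact_ee[OF ab]
      by (simp only: linear_mapsD(2)[OF TL] p VV.P.T.M.a_closed SA_simps)
  qed
  have Tid: "?T (\<lambda>t. t) t = t" if "t \<in> carrier VV.P" for t
  proof -
    note T = tensor_map[OF VV.MN.module kG.module_axioms VV_module kG.module_axioms linear_maps_id(1)[of A VV.MN, folded lin_VV(2)] linear_maps_id(2),
        unfolded tensor_VV]
    show ?thesis by (rule VV.P.tensor_ext[OF VV.P.module T(1) linear_maps_id(1) _ that]) (simp add: T(2))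
  qed
  have LD: "L (D (ee a b)) = g 1 a \<otimes> g 2 b" if ab: "a \<in> {1, 2}" "b \<in> {1, 2}" for a b
    using Lf[OF linear_maps_id(1) ab] Tid[OF linear_mapsD(1)[OF D_linear ee_closed[OF ab]]] g(1)
    by (simp add: cc_ee[unfolded One_nat_def])
  have "L (D (?\<Phi> (ee 1 1))) = (c 1 1 1 1 \<otimes> (g 1 1 \<otimes> g 2 1) \<oplus> c 1 2 1 1 \<otimes> (g 1 1 \<otimes> g 2 2))
      \<oplus> (c 2 1 1 1 \<otimes> (g 1 2 \<otimes> g 2 1) \<oplus> c 2 2 1 1 \<otimes> (g 1 2 \<otimes> g 2 2))"
    using linear_VV_expand[OF SA.module linear_maps_comp[OF D_linear L(1)] linear_mapsD(1)[OF \<Phi>' ee_closed[OF i(1) i(1)]]]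
    unfolding c_def SA_simps LD[OF i(1) i(1)] LD[OF i(1) i(2)] LD[OF i(2) i(1)] LD[OF i(2) i(2)] .
  with Lf[OF \<Phi>' i(1) i(1)] show ?thesis
    unfolding D\<Phi>[OF ee_closed[OF i(1) i(1)]] c_def by (simp only:)
qed

end


section \<open>Non-isomorphism over the integers\<close>

lemma no_Sym2_S2_iso_int: "\<phi> \<notin> comod_iso \<Z> (kG \<Z>) (Sym2_comod \<Z>) (S2_comod \<Z>)"
proof
  assume \<phi>: "\<phi> \<in> comod_iso \<Z> (kG \<Z>) (Sym2_comod \<Z>) (S2_comod \<Z>)"
  interpret Z: comm_ring_base \<Z> by (intro comm_ring_base.intro int_is_cring)
  let ?cc = "\<lambda>i j. tensor_lift \<Z> Z.SA (\<lambda>v w. v i * w j)"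
  define c where "c i j k l = ?cc i j (\<phi> (Z.class (Z.ee k l)))" for i j k l
  have l: "\<phi> \<in> linear_maps \<Z> Z.Q Z.S" and bij: "bij_betw \<phi> (carrier Z.Q) Z.symt"
    using \<phi> by (simp_all add: comod_iso_def Z.linear_maps_Sym2_S2 Z.Sym2_simps Z.S2_simps del: quot_module_simps)
  have cl: "\<phi> (Z.class (Z.ee k l)) \<in> Z.symt" if "k \<in> {1, 2}" "l \<in> {1, 2}" for k l
    using linear_mapsD(1)[OF l linear_mapsD(1)[OF Z.class_linear Z.ee_closed[OF that]]] unfolding Z.S_carrier .
  have i: "1 \<in> {1, 2::nat}" "2 \<in> {1, 2::nat}" by simp_all
  have c21: "c 2 1 1 1 = c 1 2 1 1"
    using Z.cc_swap[OF Z.symD[OF cl[OF i(1) i(1)]], of 1 2] cl[OF i(1) i(1)] unfolding c_def by simp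
  have comm: "c 1 2 2 1 = c 1 2 1 2"
    unfolding c_def using Z.class_swap[OF Z.e_carrier[OF i(1)] Z.e_carrier[OF i(2)]] by simp
  have E: "c 1 1 1 1 * (x * z) + c 1 2 1 1 * (x * w) + (c 1 2 1 1 * (y * z) + c 2 2 1 1 * (y * w))
      = c 1 2 1 1 * (x * x) + c 1 2 1 2 * (x * z) + (c 1 2 1 2 * (z * x) + c 1 2 2 2 * (z * z))"
    if "u * (x * w - y * z) = 1" for x y z w u
  proof -
    let ?g = "\<lambda>(i :: nat) (j :: nat). if i = 1 then if j = 1 then x else y else if j = 1 then z else w"
    have "u * (?g 1 1 * ?g 2 2 - ?g 1 2 * ?g 2 1) = 1" using that by simp
    from Z.Sym2_S2_hom_eval[OF \<phi> _ _ this, folded c_def] show ?thesis unfolding c21 comm by simp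
  qed
  \<comment> \<open>The instances list u, x, w, y, z in this order. The lower unipotent matrices
    with z = 1 and z = -1 give that \<open>c 1 1 1 1\<close> is \<open>2 * c 1 2 1 2\<close> plus
    and minus \<open>c 1 2 2 2\<close>, so the latter vanishes; diag(1, -1) gives
    \<open>c 1 2 1 1 = - c 1 2 1 1\<close> up to sign; the permutation matrix gives
    \<open>c 1 2 1 1 = c 1 2 2 2\<close>; the upper unipotent matrix kills
    \<open>c 2 2 1 1\<close>.\<close>
  have c0: "c 1 2 1 1 = 0" "c 2 2 1 1 = 0" "c 1 1 1 1 = 2 * c 1 2 1 2"
    using E[of 1 1 1 0 1] E[of 1 1 1 0 "- 1"] E[of "- 1" 1 "- 1" 0 0] E[of "- 1" 0 0 1 1] E[of 1 1 1 1 0]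
    by simp_all
  have e: "Z.ee 1 1 \<in> carrier Z.VV.MN" by (rule Z.ee_closed[OF i(1) i(1)])
  \<comment> \<open>\<open>?s\<close> is half of the image of the class of \<open>ee 1 1\<close>. It
    is symmetric, so surjectivity gives a preimage \<open>X\<close>, and injectivity makes that
    class equal to twice \<open>X\<close>.\<close>
  let ?s = "c 1 2 1 2 \<odot>\<^bsub>Z.VV.MN\<^esub> Z.ee 1 1"
  have "?s \<in> Z.symt"
    unfolding Z.sym_simps using e Z.swap(2)[OF Z.e_carrier[OF i(1)] Z.e_carrier[OF i(1)]]
    by (simp only: linear_mapsD(3)[OF Z.swap(1) _ e] int_Zcarr UNIV_I Z.VV.MN.T.smult_closed simp_thms)
  then have "?s \<in> \<phi> ` carrier Z.Q" unfolding bij_betw_imp_surj_on[OF bij] .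
  then obtain X where X: "X \<in> carrier Z.Q" "\<phi> X = ?s" by (rule imageE) (rule that[OF _ sym])
  let ?X = "2 \<odot>\<^bsub>Z.Q\<^esub> X"
  have cX: "?X \<in> carrier Z.Q" by (rule Z.Q.smult_closed[OF UNIV_I X(1)])
  have "\<phi> (Z.class (Z.ee 1 1)) = (2 * c 1 2 1 2) \<odot>\<^bsub>Z.VV.MN\<^esub> Z.ee 1 1"
  proof -
    have z: "0 \<odot>\<^bsub>Z.VV.MN\<^esub> Z.ee k l = \<zero>\<^bsub>Z.VV.MN\<^esub>" if "k \<in> {1, 2}" "l \<in> {1, 2}" for k l
      using Z.VV.MN.T.smult_l_null[OF Z.ee_closed[OF that]] by simp
    show ?thesis
      using Z.VV_expand[OF Z.symD[OF cl[OF i(1) i(1)]], folded c_def]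
      unfolding c21 c0 z[OF i(1) i(2)] z[OF i(2) i(1)] z[OF i(2) i(2)]
      by (simp only: Z.VV.MN.T.M.r_zero Z.VV.MN.T.M.zero_closed Z.VV.MN.T.smult_closed[OF UNIV_I e])
  qed
  also have "\<dots> = 2 \<odot>\<^bsub>Z.VV.MN\<^esub> ?s" using Z.VV.MN.T.smult_assoc1[OF _ _ e, of 2 "c 1 2 1 2"] by simp
  also have "\<dots> = \<phi> ?X" using linear_mapsD(3)[OF l int_Zcarr X(1), of 2] X(2) by (simp add: Z.VV_simps)
  finally have "Z.class (Z.ee 1 1) = ?X"
    by (rule inj_onD[OF bij_betw_imp_inj_on[OF bij] _ linear_mapsD(1)[OF Z.class_linear e] cX])
  \<comment> \<open>The coordinate \<open>?cc 1 1\<close> after \<open>Z.\<theta>\<close> is an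
    integer-valued linear functional on the symmetric square with value 1 at the class of
    \<open>ee 1 1\<close>, so this class is not twice anything.\<close>
  then have "?cc 1 1 (Z.\<theta> (Z.class (Z.ee 1 1))) = ?cc 1 1 (Z.\<theta> ?X)" by (rule arg_cong)
  moreover have "?cc 1 1 (Z.\<theta> (Z.class (Z.ee 1 1))) = 1"
    unfolding Z.\<theta>(2)[OF e] Z.polar_ee Z.cc_ee[OF i(1) i(1)] by simp
  moreover have "Z.\<theta> X \<in> carrier Z.VV.MN" using linear_mapsD(1)[OF Z.\<theta>(1) X(1)] unfolding Z.S_carrier by (rule Z.symD)
  then have "?cc 1 1 (Z.\<theta> ?X) = 2 * ?cc 1 1 (Z.\<theta> X)"
    using Z.cc_linear(2)[of 2 "Z.\<theta> X" 1 1] linear_mapsD(3)[OF Z.\<theta>(1) int_Zcarr X(1), of 2] by (simp add: Z.VV_simps)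
  ultimately show False by presburger
qed

theorem theorem1p3:
  shows "(\<forall>A :: ('a, 'r) ring_scheme. cring A \<longrightarrow>
            (\<exists>\<phi>. \<phi> \<in> comod_iso A (kN A) (res_N A (Sym2_comod A)) (res_N A (S2_comod A)) \<and>
                 \<phi> \<in> comod_iso A (kT A) (res_T A (Sym2_comod A)) (res_T A (S2_comod A)))) \<and>
         \<not> (\<exists>\<phi>. \<phi> \<in> comod_iso \<Z> (kG \<Z>) (Sym2_comod \<Z>) (S2_comod \<Z>))"
  using no_Sym2_S2_iso_int comm_ring_base.\<theta>_iso_N comm_ring_base.\<theta>_iso_T comm_ring_base.intro by blast

end
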